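(* Let $G$ be a connected graph which is a complete intersection. Then: - $2|E(G)|+4\le 3|V(G)|$ if $G$ is bipartite; - $2|E(G)|\le 3|V(G)|$ if $G$ is not bipartite.
   Context: Graphs are finite, simple (no loops, no multiple edges) and undirected. Let $k$ be an arbitrary field. For a graph $G$ with vertex set $V(G)=\{v_1,\ldots,v_m\}$ and edge set $E(G)=\{e_1,\ldots,e_n\}$, the toric ideal $P_G$ of $G$ is the kernel of the $k$-algebra homomorphism $k[x_1,\ldots,x_n]\to k[t_1,\ldots,t_m]$ induced by $x_i\mapsto t_jt_l$ whenever $e_i=\{v_j,v_l\}$. The graph $G$ is called a complete intersection if $\mu(P_G)=\mathrm{ht}(P_G)$, where $\mu(P_G)$ is the minimal number of generators of $P_G$ and $\mathrm{ht}(P_G)$ is its height.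
   Formalization: The graph G is additionally assumed to have at least one edge; this excludes only the single-vertex graph, which is connected, bipartite and a complete intersection (zero toric ideal) but violates 2|E(G)|+4 ≤ 3|V(G)|. *)

theory Defs
  imports "HOL-Algebra.RingHom" "HOL-Library.Poly_Mapping" "HOL-Library.Extended_Nat"
begin

section \<open>Finite simple graphs\<close>

definition simple_graph :: "'v set \<Rightarrow> 'v set set \<Rightarrow> bool" where
  "simple_graph V E \<longleftrightarrow> finite V \<and> (\<forall>e\<in>E. e \<subseteq> V \<and> card e = 2)"

definition connected_graph :: "'v set \<Rightarrow> 'v set set \<Rightarrow> bool" where
  "connected_graph V E \<longleftrightarrow>
     V \<noteq> {} \<and> (\<forall>u\<in>V. \<forall>v\<in>V. (u, v) \<in> {(a, b). {a, b} \<in> E}\<^sup>*)"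

definition bipartite_graph :: "'v set \<Rightarrow> 'v set set \<Rightarrow> bool" where
  "bipartite_graph V E \<longleftrightarrow>
     (\<exists>A B. A \<union> B = V \<and> A \<inter> B = {} \<and> (\<forall>e\<in>E. \<exists>a\<in>A. \<exists>b\<in>B. e = {a, b}))"


section \<open>Minimal number of generators and height of an ideal\<close>

text \<open>Both invariants are \<infinity> where no finite value exists: no finite generating set,
  respectively prime chains of unbounded length (or no prime ideal above \<open>I\<close>).\<close>

definition min_generators :: "('a, 'm) ring_scheme \<Rightarrow> 'a set \<Rightarrow> enat" where
  "min_generators R I = (INF S\<in>{S. finite S \<and> S \<subseteq> carrier R \<and> Idl\<^bsub>R\<^esub> S = I}. enat (card S))"

definition prime_height :: "('a, 'm) ring_scheme \<Rightarrow> 'a set \<Rightarrow> enat" where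
  "prime_height R P = Sup {enat n | n. \<exists>c :: nat \<Rightarrow> 'a set.
     c n = P \<and> (\<forall>i\<le>n. primeideal (c i) R) \<and> (\<forall>i<n. c i \<subset> c (Suc i))}"

definition ideal_height :: "('a, 'm) ring_scheme \<Rightarrow> 'a set \<Rightarrow> enat" where
  "ideal_height R I = (INF P\<in>{P. primeideal P R \<and> I \<subseteq> P}. prime_height R P)"


section \<open>Polynomial rings\<close>

text \<open>A polynomial is a finitely supported map from monomials to coefficients, a monomial a
  finitely supported map from variables to exponents. The ring \<open>k[x\<^sub>i : i \<in> I]\<close> consists of those
  polynomials in which only variables from \<open>I\<close> occur, so that \<open>I\<close> need not be a whole type.\<close>

type_synonym ('x, 'k) mpoly = "('x \<Rightarrow>\<^sub>0 nat) \<Rightarrow>\<^sub>0 'k"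

definition mpoly_ring :: "'x set \<Rightarrow> ('x, 'k::field) mpoly ring" where
  "mpoly_ring I = \<lparr>carrier = {p. \<forall>m\<in>Poly_Mapping.keys p. Poly_Mapping.keys m \<subseteq> I},
     mult = (*), one = 1, zero = 0, add = (+)\<rparr>"

definition mconst :: "'k::field \<Rightarrow> ('x, 'k) mpoly" where
  "mconst c = Poly_Mapping.single 0 c"

definition mvar :: "'x \<Rightarrow> ('x, 'k::field) mpoly" where
  "mvar x = Poly_Mapping.single (Poly_Mapping.single x 1) 1"

definition mpoly_subst :: "('x \<Rightarrow> ('y, 'k::field) mpoly) \<Rightarrow> ('x, 'k) mpoly \<Rightarrow> ('y, 'k) mpoly" where
  "mpoly_subst f p = (\<Sum>m\<in>Poly_Mapping.keys p. mconst (Poly_Mapping.lookup p m) *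
     (\<Prod>x\<in>Poly_Mapping.keys m. f x ^ Poly_Mapping.lookup m x))"

lemma mpoly_ring_simps [simp]:
  "p \<in> carrier (mpoly_ring I) \<longleftrightarrow> (\<forall>m\<in>Poly_Mapping.keys p. Poly_Mapping.keys m \<subseteq> I)"
  "p \<otimes>\<^bsub>mpoly_ring I\<^esub> q = p * q" "p \<oplus>\<^bsub>mpoly_ring I\<^esub> q = p + q"
  "\<one>\<^bsub>mpoly_ring I\<^esub> = 1" "\<zero>\<^bsub>mpoly_ring I\<^esub> = 0"
  by (simp_all add: mpoly_ring_def)

lemma mpoly_ring_closed:
  "0 \<in> carrier (mpoly_ring I)" "1 \<in> carrier (mpoly_ring I)"
  "p \<in> carrier (mpoly_ring I) \<Longrightarrow> - p \<in> carrier (mpoly_ring I)"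
  "p \<in> carrier (mpoly_ring I) \<Longrightarrow> q \<in> carrier (mpoly_ring I) \<Longrightarrow> p + q \<in> carrier (mpoly_ring I)"
  "p \<in> carrier (mpoly_ring I) \<Longrightarrow> q \<in> carrier (mpoly_ring I) \<Longrightarrow> p * q \<in> carrier (mpoly_ring I)"
  "mconst c \<in> carrier (mpoly_ring I)" "x \<in> I \<Longrightarrow> mvar x \<in> carrier (mpoly_ring I)"
proof -
  show "p + q \<in> carrier (mpoly_ring I)"
    if "p \<in> carrier (mpoly_ring I)" "q \<in> carrier (mpoly_ring I)"
    using that Poly_Mapping.keys_add[of p q] by auto
  show "p * q \<in> carrier (mpoly_ring I)"
    if "p \<in> carrier (mpoly_ring I)" "q \<in> carrier (mpoly_ring I)"
  proof -
    have "Poly_Mapping.keys m \<subseteq> I" if "m \<in> Poly_Mapping.keys (p * q)" for m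
    proof -
      from that obtain a b where "m = a + b" "a \<in> Poly_Mapping.keys p" "b \<in> Poly_Mapping.keys q"
        using Poly_Mapping.keys_mult[of p q] by auto
      with \<open>p \<in> _\<close> \<open>q \<in> _\<close> show ?thesis
        using Poly_Mapping.keys_add[of a b] by fastforce
    qed
    then show ?thesis by simp
  qed
qed (auto simp: mconst_def mvar_def)

lemma cring_mpoly_ring: "cring (mpoly_ring I)"
proof (rule cringI)
  show "abelian_group (mpoly_ring I)"
  proof (rule abelian_groupI)
    show "\<exists>q\<in>carrier (mpoly_ring I). q \<oplus>\<^bsub>mpoly_ring I\<^esub> p = \<zero>\<^bsub>mpoly_ring I\<^esub>"
      if "p \<in> carrier (mpoly_ring I)" for p
      using mpoly_ring_closed(3)[OF that] by (intro bexI[of _ "- p"]) simp_all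
  qed (use mpoly_ring_closed in \<open>auto simp del: mpoly_ring_simps(1) simp: algebra_simps\<close>)
  show "comm_monoid (mpoly_ring I)"
    by (rule comm_monoidI)
      (use mpoly_ring_closed in \<open>auto simp del: mpoly_ring_simps(1) simp: algebra_simps\<close>)
qed (auto simp: algebra_simps)

lemma poly_mapping_sum_single:
  fixes p :: "'a \<Rightarrow>\<^sub>0 'b::comm_monoid_add"
  shows "p = (\<Sum>m\<in>Poly_Mapping.keys p. Poly_Mapping.single m (Poly_Mapping.lookup p m))"
  by (rule poly_mapping_eqI) (simp add: lookup_sum lookup_single when_def in_keys_iff)

lemma mpoly_subst_superset:
  assumes "finite M" "Poly_Mapping.keys p \<subseteq> M"
  shows "mpoly_subst f p = (\<Sum>m\<in>M. mconst (Poly_Mapping.lookup p m) *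
     (\<Prod>x\<in>Poly_Mapping.keys m. f x ^ Poly_Mapping.lookup m x))"
  unfolding mpoly_subst_def
  by (rule sum.mono_neutral_left) (use assms in \<open>auto simp: mconst_def in_keys_iff\<close>)

lemma mpoly_subst_add: "mpoly_subst f (p + q) = mpoly_subst f p + mpoly_subst f q"
proof -
  let ?M = "Poly_Mapping.keys p \<union> Poly_Mapping.keys q"
  have "Poly_Mapping.keys (p + q) \<subseteq> ?M" by (rule Poly_Mapping.keys_add)
  then show ?thesis
    by (simp add: mpoly_subst_superset[of ?M] lookup_add mconst_def single_add
        distrib_right sum.distrib)
qed

lemma mpoly_subst_zero [simp]: "mpoly_subst f 0 = 0"
  by (simp add: mpoly_subst_def)

lemma mpoly_subst_sum: "mpoly_subst f (\<Sum>i\<in>A. g i) = (\<Sum>i\<in>A. mpoly_subst f (g i))"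
  by (induction A rule: infinite_finite_induct) (simp_all add: mpoly_subst_add)

lemma mpoly_subst_single:
  "mpoly_subst f (Poly_Mapping.single m c) =
     mconst c * (\<Prod>x\<in>Poly_Mapping.keys m. f x ^ Poly_Mapping.lookup m x)"
  by (simp add: mpoly_subst_superset[of "{m}"])

lemma mpoly_subst_const [simp]: "mpoly_subst f (mconst c) = mconst c"
  by (simp add: mconst_def mpoly_subst_single)

lemma mpoly_subst_var [simp]: "mpoly_subst f (mvar x) = f x"
  by (simp add: mvar_def mpoly_subst_single mconst_def)

lemma mpoly_subst_mult: "mpoly_subst f (p * q) = mpoly_subst f p * mpoly_subst f q"
proof -
  have monom: "(\<Prod>x\<in>Poly_Mapping.keys (a + b). f x ^ Poly_Mapping.lookup (a + b) x) =
      (\<Prod>x\<in>Poly_Mapping.keys a. f x ^ Poly_Mapping.lookup a x) *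
      (\<Prod>x\<in>Poly_Mapping.keys b. f x ^ Poly_Mapping.lookup b x)" for a b
  proof -
    let ?U = "Poly_Mapping.keys a \<union> Poly_Mapping.keys b"
    have ext: "(\<Prod>x\<in>Poly_Mapping.keys m. f x ^ Poly_Mapping.lookup m x) =
        (\<Prod>x\<in>?U. f x ^ Poly_Mapping.lookup m x)" if "Poly_Mapping.keys m \<subseteq> ?U" for m
      by (rule prod.mono_neutral_left) (use that in \<open>auto simp: in_keys_iff\<close>)
    show ?thesis
      unfolding ext[OF Poly_Mapping.keys_add] ext[OF Un_upper1] ext[OF Un_upper2]
      by (simp add: lookup_add power_add prod.distrib)
  qed
  have "p * q = (\<Sum>a\<in>Poly_Mapping.keys p. Poly_Mapping.single a (Poly_Mapping.lookup p a)) *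
      (\<Sum>b\<in>Poly_Mapping.keys q. Poly_Mapping.single b (Poly_Mapping.lookup q b))"
    by (rule arg_cong2[of _ _ _ _ "(*)", OF poly_mapping_sum_single poly_mapping_sum_single])
  then have "p * q = (\<Sum>a\<in>Poly_Mapping.keys p. \<Sum>b\<in>Poly_Mapping.keys q.
      Poly_Mapping.single (a + b) (Poly_Mapping.lookup p a * Poly_Mapping.lookup q b))"
    by (simp add: sum_product mult_single)
  then show ?thesis
    by (simp add: mpoly_subst_sum mpoly_subst_single monom)
      (simp add: mpoly_subst_def sum_product mconst_def mult_single[symmetric] mult_ac
        flip: mult_single[of 0 _ 0, simplified])
qed

lemma mpoly_subst_mvar: "mpoly_subst mvar p = p"
proof -
  have pow: "mvar x ^ n = (Poly_Mapping.single (Poly_Mapping.single x n) 1 :: ('a, 'b) mpoly)" for x n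
    by (induction n) (simp_all add: mvar_def mult_single flip: single_add)
  have prod: "(\<Prod>x\<in>A. mvar x ^ n x) =
      (Poly_Mapping.single (\<Sum>x\<in>A. Poly_Mapping.single x (n x)) 1 :: ('a, 'b) mpoly)" for A n
    by (induction A rule: infinite_finite_induct) (simp_all add: pow mult_single)
  show ?thesis
    unfolding mpoly_subst_def prod poly_mapping_sum_single[symmetric] mconst_def mult_single
    by (simp add: poly_mapping_sum_single[symmetric])
qed

lemma mpoly_subst_closed:
  assumes "p \<in> carrier (mpoly_ring I)" "\<And>x. x \<in> I \<Longrightarrow> f x \<in> carrier (mpoly_ring J)"
  shows "mpoly_subst f p \<in> carrier (mpoly_ring J)"
proof -
  have S: "(\<Sum>i\<in>A. g i) \<in> carrier (mpoly_ring J)"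
    if "\<And>i. i \<in> A \<Longrightarrow> g i \<in> carrier (mpoly_ring J)" for A :: "('a \<Rightarrow>\<^sub>0 nat) set" and g
    using that by (induction A rule: infinite_finite_induct)
      (auto simp del: mpoly_ring_simps intro!: mpoly_ring_closed)
  have W: "g ^ n \<in> carrier (mpoly_ring J)" if "g \<in> carrier (mpoly_ring J)" for g n
    using that by (induction n) (auto simp del: mpoly_ring_simps intro!: mpoly_ring_closed)
  have P: "(\<Prod>i\<in>A. g i) \<in> carrier (mpoly_ring J)"
    if "\<And>i. i \<in> A \<Longrightarrow> g i \<in> carrier (mpoly_ring J)" for A :: "'a set" and g
    using that by (induction A rule: infinite_finite_induct)
      (auto simp del: mpoly_ring_simps intro!: mpoly_ring_closed)
  show ?thesis
    unfolding mpoly_subst_def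
    by (intro S mpoly_ring_closed P W assms(2)) (use assms(1) in auto)
qed

lemma mpoly_subst_ring_hom:
  assumes "\<And>x. x \<in> I \<Longrightarrow> f x \<in> carrier (mpoly_ring J)"
  shows "mpoly_subst f \<in> ring_hom (mpoly_ring I) (mpoly_ring J)"
proof (rule ring_hom_memI)
  have "mpoly_subst f 1 = 1"
    using mpoly_subst_const[of f 1] by (simp add: mconst_def)
  then show "mpoly_subst f \<one>\<^bsub>mpoly_ring I\<^esub> = \<one>\<^bsub>mpoly_ring J\<^esub>" by simp
qed (simp_all del: mpoly_ring_simps(1)
    add: mpoly_subst_add mpoly_subst_mult mpoly_subst_closed[OF _ assms])

lemma mpoly_subst_unique:
  fixes h :: "('a, 'b::field) mpoly \<Rightarrow> ('c, 'b) mpoly"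
  assumes "h \<in> ring_hom (mpoly_ring I) (mpoly_ring J)"
    and "\<And>c. h (mconst c) = mconst c" "\<And>x. x \<in> I \<Longrightarrow> h (mvar x) = f x"
    and "p \<in> carrier (mpoly_ring I)"
  shows "h p = mpoly_subst f p"
proof -
  have h: "h 1 = 1" "h 0 = 0"
      "\<And>p q. p \<in> carrier (mpoly_ring I) \<Longrightarrow> q \<in> carrier (mpoly_ring I) \<Longrightarrow>
        h (p + q) = h p + h q \<and> h (p * q) = h p * h q"
    using ring_hom_one[OF assms(1)] assms(2)[of 0] ring_hom_add[OF assms(1)]
      ring_hom_mult[OF assms(1)]
    by (simp_all add: mconst_def del: mpoly_ring_simps(1))
  have pow: "v ^ n \<in> carrier (mpoly_ring I) \<and> h (v ^ n) = h v ^ n"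
    if "v \<in> carrier (mpoly_ring I)" for v n
    by (induction n) (use that h mpoly_ring_closed in \<open>auto simp del: mpoly_ring_simps(1)\<close>)
  have prod: "(\<Prod>x\<in>A. mvar x ^ n x :: ('a, 'b) mpoly) \<in> carrier (mpoly_ring I) \<and>
      h (\<Prod>x\<in>A. mvar x ^ n x) = (\<Prod>x\<in>A. f x ^ n x)" if "A \<subseteq> I" for A and n :: "'a \<Rightarrow> nat"
    using that
  proof (induction A rule: infinite_finite_induct)
    case (insert x F)
    then have x: "(mvar x :: ('a, 'b) mpoly) \<in> carrier (mpoly_ring I)" and hx: "h (mvar x) = f x"
      by (simp_all del: mpoly_ring_simps(1) add: mpoly_ring_closed(7) assms(3))
    have "(mvar x ^ n x :: ('a, 'b) mpoly) \<in> carrier (mpoly_ring I)" "h (mvar x ^ n x) = f x ^ n x"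
      using conjunct1[OF pow[OF x]] conjunct2[OF pow[OF x]] unfolding hx by this+
    with insert show ?case
      by (simp del: mpoly_ring_simps(1) add: h(3) mpoly_ring_closed(5))
  qed (simp_all add: h del: mpoly_ring_simps(1) add: mpoly_ring_closed)
  have sum: "(\<Sum>m\<in>A. g m) \<in> carrier (mpoly_ring I) \<and> h (\<Sum>m\<in>A. g m) = (\<Sum>m\<in>A. h (g m))"
    if "\<And>m. m \<in> A \<Longrightarrow> g m \<in> carrier (mpoly_ring I)" for A :: "('a \<Rightarrow>\<^sub>0 nat) set" and g
    using that
    by (induction A rule: infinite_finite_induct)
      (simp_all del: mpoly_ring_simps(1) add: h mpoly_ring_closed)
  let ?t = "\<lambda>m. mconst (Poly_Mapping.lookup p m) *
    (\<Prod>x\<in>Poly_Mapping.keys m. mvar x ^ Poly_Mapping.lookup m x)"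
  have sub: "Poly_Mapping.keys m \<subseteq> I" if "m \<in> Poly_Mapping.keys p" for m
    using assms(4) that by auto
  have t: "?t m \<in> carrier (mpoly_ring I) \<and> h (?t m) = mconst (Poly_Mapping.lookup p m) *
      (\<Prod>x\<in>Poly_Mapping.keys m. f x ^ Poly_Mapping.lookup m x)"
    if "m \<in> Poly_Mapping.keys p" for m
    using prod[OF sub[OF that]]
    by (simp del: mpoly_ring_simps(1) add: h(3) mpoly_ring_closed(5,6) assms(2))
  have "p = (\<Sum>m\<in>Poly_Mapping.keys p. ?t m)"
    using mpoly_subst_mvar[of p] by (simp add: mpoly_subst_def)
  then have "h p = (\<Sum>m\<in>Poly_Mapping.keys p. h (?t m))"
    using sum[of "Poly_Mapping.keys p" ?t] t by simp
  then show ?thesis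
    using t by (simp add: mpoly_subst_def)
qed


section \<open>Toric ideals of graphs\<close>

text \<open>The variables of the source ring are the edges of the graph and those of the target ring
  its vertices; \<open>x\<^sub>e\<close> goes to \<open>t\<^sub>u t\<^sub>v\<close> for \<open>e = {u, v}\<close>.\<close>

definition toric_ideal :: "'v set \<Rightarrow> 'v set set \<Rightarrow> ('v set, 'k::field) mpoly set" where
  "toric_ideal V E =
     a_kernel (mpoly_ring E) (mpoly_ring V) (mpoly_subst (\<lambda>e. \<Prod>v\<in>e. mvar v))"

text \<open>The first argument only names the field \<open>k\<close>.\<close>

definition complete_intersection :: "'k::field itself \<Rightarrow> 'v set \<Rightarrow> 'v set set \<Rightarrow> bool" where
  "complete_intersection _ V E \<longleftrightarrow>
     min_generators (mpoly_ring E) (toric_ideal V E :: ('v set, 'k) mpoly set) =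
     ideal_height (mpoly_ring E) (toric_ideal V E :: ('v set, 'k) mpoly set)"

end

theory Submission
  imports Defs
begin

text \<open>Let \<open>P\<close> be the toric ideal of the connected graph, \<open>r\<close> the number of its minimal generators and
  \<open>rk\<close> the rank of the incidence vectors of edges over the rationals. The ideal is graded by degrees
  in \<open>\<nat>\<close> to the power \<open>V\<close>, and it suffices to bound, for every vertex \<open>v\<close>, the number of minimal
  generators whose degree involves \<open>v\<close>:
  \<^item> In total there are at most \<open>card E - rk E\<close> generators, because \<open>P\<close> is a complete intersection of
    at most that height (\<open>ideal_height_toric_le\<close>).
  \<^item> The generators that do not involve \<open>v\<close> generate the toric ideal of the graph without \<open>v\<close>, so
    their differences of exponents span all linear relations between the remaining incidence
    vectors; hence they are at least as many as the remaining edges minus the remaining rank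
    (\<open>many_critical_or_independent_edges\<close>). The rank drops on removing \<open>v\<close>,
    as connectedness excludes isolated vertices.

  So fewer than \<open>deg v\<close> generators involve \<open>v\<close> (\<open>critical_at_vertex_less_degree\<close>). On the other hand
  each generator involves at least four vertices (\<open>four_vertices_of_critical\<close>). Summation over all
  vertices gives \<open>4 r \<le> 2 card E - card V\<close>. As the generators span all relations between incidence
  vectors, \<open>r \<ge> card E - rk E\<close>, where the rank is at most \<open>card V\<close>, and at most \<open>card V - 1\<close> for a
  bipartite graph. Both inequalities follow.

  Instead of a minimal set of generators the proof uses the combinatorics behind it. The monomials of
  a given degree form a fibre, which splits into components under the relation of having a common
  variable; the number of minimal generators in that degree is the number of components minus one.
  Components yield linear functionals on \<open>P\<close> that show that no generating set is smaller
  (\<open>finite_critical_card_le\<close>), and the critical pairs yield enough binomials to generate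
  (\<open>critical_pairs_generate\<close>).

  The bound on the height is elementary as well: along a chain of primes ending in \<open>P\<close>, independent
  elements of the residue ring can be extended by one element in every step, and polynomials in
  \<open>card E\<close> variables do not admit more than \<open>card E\<close> algebraically independent elements.\<close>

alias lookup = Poly_Mapping.lookup
alias keys = Poly_Mapping.keys
alias single = Poly_Mapping.single

section \<open>Homogeneous linear systems\<close>

lemma underdetermined_system:
  fixes c :: "'a \<Rightarrow> 'b \<Rightarrow> 'k::idom"
  assumes "finite B" "finite A" "card B < card A"
  shows "\<exists>l. (\<exists>a\<in>A. l a \<noteq> 0) \<and> (\<forall>b\<in>B. (\<Sum>a\<in>A. l a * c a b) = 0)"
  using assms
proof (induction B arbitrary: A c rule: finite_induct)
  case empty
  then have "A \<noteq> {}" by auto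
  then show ?case by (intro exI[of _ "\<lambda>_. 1"]) auto
next
  case (insert b B)
  show ?case
  proof (cases "\<forall>a\<in>A. c a b = 0")
    case True
    then show ?thesis using insert.IH[of A c] insert.prems insert.hyps by auto
  next
    case False
    then obtain p where p: "p \<in> A" "c p b \<noteq> 0" by auto
    let ?A = "A - {p}"
    \<comment> \<open>Fraction-free elimination of the unknown \<open>p\<close> by means of the equation \<open>b\<close>.\<close>
    let ?c = "\<lambda>a b'. c p b * c a b' - c a b * c p b'"
    have "card B < card ?A" using insert.prems insert.hyps p by simp
    then obtain l where l: "\<exists>a\<in>?A. l a \<noteq> 0" "\<forall>b'\<in>B. (\<Sum>a\<in>?A. l a * ?c a b') = 0"
      using insert.IH[of ?A ?c] insert.prems by auto
    let ?l = "\<lambda>a. if a = p then - (\<Sum>a\<in>?A. l a * c a b) else c p b * l a"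
    have "(\<Sum>a\<in>A. ?l a * c a b') = (\<Sum>a\<in>?A. l a * ?c a b')" for b'
    proof -
      have "(\<Sum>a\<in>A. ?l a * c a b') = ?l p * c p b' + (\<Sum>a\<in>?A. ?l a * c a b')"
        using p insert.prems by (simp add: sum.remove)
      also have "(\<Sum>a\<in>?A. ?l a * c a b') = (\<Sum>a\<in>?A. c p b * l a * c a b')"
        by (rule sum.cong) auto
      finally show ?thesis
        by (simp add: sum_distrib_right sum_distrib_left sum_subtractf[symmetric] sum_negf[symmetric]
            sum.distrib[symmetric] algebra_simps)
    qed
    moreover have "(\<Sum>a\<in>?A. l a * ?c a b) = 0" by simp
    ultimately have "\<forall>b'\<in>insert b B. (\<Sum>a\<in>A. ?l a * c a b') = 0" using l(2) by simp
    moreover have "\<exists>a\<in>A. ?l a \<noteq> 0" using l(1) p by auto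
    ultimately show ?thesis by (rule_tac exI[of _ ?l]) blast
  qed
qed

section \<open>Monomial substitutions\<close>

text \<open>The exponent of the image of the monomial \<open>m\<close> when each variable \<open>i\<close> is replaced by the monomial
  with exponent \<open>g i\<close>. Inner sums of constants stand for the action of \<open>\<nat>\<close> on exponents.\<close>
definition mon_map :: "('i \<Rightarrow> 'j \<Rightarrow>\<^sub>0 nat) \<Rightarrow> ('i \<Rightarrow>\<^sub>0 nat) \<Rightarrow> ('j \<Rightarrow>\<^sub>0 nat)" where
  "mon_map g m = (\<Sum>i\<in>keys m. \<Sum>_<lookup m i. g i)"

lemma lookup_mon_map_superset:
  assumes "finite J" "keys m \<subseteq> J"
  shows "lookup (mon_map g m) j = (\<Sum>i\<in>J. lookup m i * lookup (g i) j)"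
proof -
  have "lookup (mon_map g m) j = (\<Sum>i\<in>keys m. lookup m i * lookup (g i) j)"
    by (simp add: mon_map_def lookup_sum)
  also have "\<dots> = (\<Sum>i\<in>J. lookup m i * lookup (g i) j)"
    by (rule sum.mono_neutral_left) (use assms in \<open>auto simp: in_keys_iff\<close>)
  finally show ?thesis .
qed

lemma mon_map_add: "mon_map g (m + n) = mon_map g m + mon_map g n"
proof (rule poly_mapping_eqI)
  fix j
  let ?J = "keys m \<union> keys n"
  have "keys (m + n) \<subseteq> ?J" by (rule Poly_Mapping.keys_add)
  then show "lookup (mon_map g (m + n)) j = lookup (mon_map g m + mon_map g n) j"
    by (simp add: lookup_mon_map_superset[of ?J] lookup_add distrib_right sum.distrib)
qed

lemma mon_map_single: "mon_map g (single i 1) = g i"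
  by (rule poly_mapping_eqI) (simp add: lookup_mon_map_superset[of "{i}"])

lemma single_power: "single m (1::'k::field) ^ n = single (\<Sum>_<n. m) 1"
  by (induction n) (simp_all add: mult_single add.commute)

lemma prod_single: "(\<Prod>x\<in>A. single (m x) (1::'k::field)) = single (\<Sum>x\<in>A. m x) 1"
  by (induction A rule: infinite_finite_induct) (simp_all add: mult_single)

lemma mpoly_subst_monomials:
  assumes "p \<in> carrier (mpoly_ring J)" "\<And>i. i \<in> J \<Longrightarrow> f i = single (g i) (1::'k::field)"
  shows "mpoly_subst f p = (\<Sum>m\<in>keys p. single (mon_map g m) (lookup p m))"
  unfolding mpoly_subst_def
proof (rule sum.cong[OF refl])
  fix m assume "m \<in> keys p"
  then have "keys m \<subseteq> J" using assms(1) by auto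
  then have "(\<Prod>x\<in>keys m. f x ^ lookup m x) = (\<Prod>x\<in>keys m. single (\<Sum>_<lookup m x. g x) (1::'k))"
    by (intro prod.cong refl) (use assms(2) in \<open>auto simp: single_power\<close>)
  then show "mconst (lookup p m) * (\<Prod>x\<in>keys m. f x ^ lookup m x)
      = single (mon_map g m) (lookup p m)"
    by (simp add: prod_single mconst_def mult_single mon_map_def)
qed

lemma lookup_mpoly_subst_monomials:
  assumes "p \<in> carrier (mpoly_ring J)" "\<And>i. i \<in> J \<Longrightarrow> f i = single (g i) (1::'k::field)"
  shows "lookup (mpoly_subst f p) d = (\<Sum>m\<in>{m \<in> keys p. mon_map g m = d}. lookup p m)"
proof -
  have "lookup (mpoly_subst f p) d = (\<Sum>m\<in>keys p. if mon_map g m = d then lookup p m else 0)"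
    by (simp only: mpoly_subst_monomials[OF assms] lookup_sum lookup_single when_def)
  then show ?thesis by (simp add: sum.inter_filter)
qed

text \<open>Injectivity on exponents means that no two monomials of \<open>p\<close> collide, so nothing can cancel.\<close>
lemma mpoly_subst_monomials_inject:
  assumes "p \<in> carrier (mpoly_ring J)" "\<And>i. i \<in> J \<Longrightarrow> f i = single (g i) (1::'k::field)"
    and inj: "inj_on (mon_map g) {m. keys m \<subseteq> J}" and "mpoly_subst f p = 0"
  shows "p = 0"
proof (rule ccontr)
  assume "p \<noteq> 0"
  then obtain m where m: "m \<in> keys p" using keys_eq_empty by blast
  have "{n \<in> keys p. mon_map g n = mon_map g m} = {m}"
    using assms(1) m inj_onD[OF inj] by auto
  then have "lookup (mpoly_subst f p) (mon_map g m) = lookup p m"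
    by (simp add: lookup_mpoly_subst_monomials[OF assms(1,2)])
  with assms(4) m show False by (simp add: in_keys_iff)
qed

lemma mpoly_subst_1 [simp]: "mpoly_subst f 1 = 1"
  using mpoly_subst_const[of f 1] by (simp add: mconst_def)

lemma mpoly_subst_prod: "mpoly_subst f (\<Prod>i\<in>A. g i) = (\<Prod>i\<in>A. mpoly_subst f (g i))"
  by (induction A rule: infinite_finite_induct) (simp_all add: mpoly_subst_mult)

lemma mpoly_subst_power: "mpoly_subst f (p ^ n) = mpoly_subst f p ^ n"
  by (induction n) (simp_all add: mpoly_subst_mult)

lemma mpoly_subst_comp: "mpoly_subst f (mpoly_subst g p) = mpoly_subst (\<lambda>x. mpoly_subst f (g x)) p"
  unfolding mpoly_subst_def[of g] mpoly_subst_def[of "\<lambda>x. mpoly_subst f (g x)"]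
  by (simp add: mpoly_subst_sum mpoly_subst_mult mpoly_subst_prod mpoly_subst_power)

section \<open>Prime ideals and algebraic independence\<close>

text \<open>Finitely many variables can be renamed to natural numbers; the linear order of these makes leading
  monomials multiplicative.\<close>
lemma mult_eq_0_imp_eq_0_mpoly:
  fixes p q :: "('x, 'k::field) mpoly"
  assumes "finite V" "p \<in> carrier (mpoly_ring V)" "q \<in> carrier (mpoly_ring V)" "p * q = 0"
  shows "p = 0 \<or> q = 0"
proof -
  obtain f :: "'x \<Rightarrow> nat" where f: "inj_on f V"
    using finite_imp_inj_to_nat_seg[OF assms(1)] by blast
  define g :: "'x \<Rightarrow> nat \<Rightarrow>\<^sub>0 nat" where "g = (\<lambda>v. single (f v) 1)"
  let ?h = "mpoly_subst (\<lambda>v. single (g v) (1::'k))"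
  have "lookup (mon_map g m) (f v) = lookup m v" if "keys m \<subseteq> V" "v \<in> V" for m v
  proof -
    have "lookup (mon_map g m) (f v) = (\<Sum>i\<in>V. lookup m i * lookup (g i) (f v))"
      by (rule lookup_mon_map_superset) (use assms(1) that in auto)
    also have "\<dots> = (\<Sum>i\<in>V. if i = v then lookup m i else 0)"
      by (rule sum.cong) (use f that in \<open>auto simp: g_def lookup_single when_def inj_on_eq_iff\<close>)
    finally show ?thesis using assms(1) that by simp
  qed
  note look = this
  have inj: "inj_on (mon_map g) {m. keys m \<subseteq> V}"
  proof (intro inj_onI poly_mapping_eqI)
    fix m n v
    assume *: "m \<in> {m. keys m \<subseteq> V}" "n \<in> {m. keys m \<subseteq> V}" "mon_map g m = mon_map g n"
    show "lookup m v = lookup n v"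
    proof (cases "v \<in> V")
      case True
      then show ?thesis using look[of m v] look[of n v] * by simp
    next
      case False
      then have "v \<notin> keys m" "v \<notin> keys n" using * by auto
      then show ?thesis by (simp add: in_keys_iff)
    qed
  qed
  have "?h p * ?h q = 0" using assms(4) by (simp flip: mpoly_subst_mult)
  then have "?h p = 0 \<or> ?h q = 0" by simp
  moreover have "r = 0" if "r \<in> carrier (mpoly_ring V)" "?h r = 0" for r
    by (rule mpoly_subst_monomials_inject[OF that(1) refl inj that(2)])
  ultimately show ?thesis using assms(2,3) by blast
qed

text \<open>The elements of \<open>Y\<close> serve as the names of the variables that are to be replaced by them, so that
  a relation between elements of \<open>Y\<close> is a polynomial over \<open>Y\<close>, evaluated by \<open>mpoly_subst id\<close>.\<close>
definition alg_indep_mod :: "('x, 'k::field) mpoly set \<Rightarrow> ('x, 'k) mpoly set \<Rightarrow> bool" where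
  "alg_indep_mod P Y \<longleftrightarrow> (\<forall>q\<in>carrier (mpoly_ring Y). q \<noteq> 0 \<longrightarrow> mpoly_subst id q \<notin> P)"

lemma carrier_mpoly_ring_sum:
  "(\<And>i. i \<in> A \<Longrightarrow> g i \<in> carrier (mpoly_ring J)) \<Longrightarrow> (\<Sum>i\<in>A. g i) \<in> carrier (mpoly_ring J)"
  by (induction A rule: infinite_finite_induct)
    (auto simp del: mpoly_ring_simps intro!: mpoly_ring_closed)

lemma carrier_mpoly_ring_single: "keys m \<subseteq> J \<Longrightarrow> single m c \<in> carrier (mpoly_ring J)"
  by auto

text \<open>Separating the constant term with respect to one variable; the bound on the exponents of that
  variable drops and drives the induction in \<open>alg_indep_mod_insert\<close>.\<close>
lemma mpoly_split_variable:
  fixes q :: "('x, 'k::field) mpoly"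
  assumes q: "q \<in> carrier (mpoly_ring (insert y Y))"
    and n: "\<And>m. m \<in> keys q \<Longrightarrow> lookup m y < Suc n"
  obtains q0 q1 where "q0 \<in> carrier (mpoly_ring Y)" "q1 \<in> carrier (mpoly_ring (insert y Y))"
    "q = q0 + mvar y * q1" "\<And>m. m \<in> keys q1 \<Longrightarrow> lookup m y < n"
proof
  let ?A = "{m \<in> keys q. lookup m y = 0}" and ?B = "{m \<in> keys q. lookup m y \<noteq> 0}"
  let ?q0 = "\<Sum>m\<in>?A. single m (lookup q m)"
  let ?q1 = "\<Sum>m\<in>?B. single (m - single y 1) (lookup q m)"
  show "?q0 \<in> carrier (mpoly_ring Y)"
  proof (intro carrier_mpoly_ring_sum carrier_mpoly_ring_single)
    fix m assume m: "m \<in> ?A"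
    then have "keys m \<subseteq> insert y Y" "y \<notin> keys m" using q by (auto simp: in_keys_iff)
    then show "keys m \<subseteq> Y" by blast
  qed
  show "?q1 \<in> carrier (mpoly_ring (insert y Y))"
  proof (intro carrier_mpoly_ring_sum carrier_mpoly_ring_single)
    fix m assume "m \<in> ?B"
    then have "keys m \<subseteq> insert y Y" using q by auto
    moreover have "keys (m - single y 1) \<subseteq> keys m"
      by (rule subsetI) (simp add: in_keys_iff lookup_minus)
    ultimately show "keys (m - single y 1) \<subseteq> insert y Y" by blast
  qed
  have B: "single y 1 + (m - single y 1) = m" if "m \<in> ?B" for m
    by (rule poly_mapping_eqI) (use that in \<open>auto simp add: lookup_add lookup_minus lookup_single when_def\<close>)
  have "q = (\<Sum>m\<in>keys q. single m (lookup q m))" by (rule poly_mapping_sum_single)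
  also have "keys q = ?A \<union> ?B" by auto
  also have "(\<Sum>m\<in>?A \<union> ?B. single m (lookup q m))
      = ?q0 + (\<Sum>m\<in>?B. single m (lookup q m))"
    by (rule sum.union_disjoint) auto
  also have "(\<Sum>m\<in>?B. single m (lookup q m)) = mvar y * ?q1"
    unfolding sum_distrib_left mvar_def mult_single using B by (intro sum.cong) simp_all
  finally show "q = ?q0 + mvar y * ?q1" .
  fix m assume "m \<in> keys ?q1"
  then obtain k where k: "k \<in> ?B" "m \<in> keys (single (k - single y 1) (lookup q k))"
    using subsetD[OF keys_sum] by (metis (no_types, lifting) UN_E)
  then have "m = k - single y 1" by (auto split: if_splits)
  then have "lookup m y = lookup k y - 1" by (simp add: lookup_minus)
  moreover have "lookup k y < Suc n" "lookup k y \<noteq> 0" using n k(1) by auto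
  ultimately show "lookup m y < n" by linarith
qed

lemma mpoly_subst_id_closed:
  assumes "q \<in> carrier (mpoly_ring Y)" "Y \<subseteq> carrier (mpoly_ring I)"
  shows "mpoly_subst id q \<in> carrier (mpoly_ring I)"
  by (rule mpoly_subst_closed[OF assms(1)], unfold id_apply) (use assms(2) in blast)

text \<open>A relation between \<open>f\<close> and the elements of \<open>Y\<close> that holds modulo \<open>P\<close> holds modulo \<open>Q\<close>, where \<open>f\<close>
  vanishes; so its part free of \<open>f\<close> is a relation of \<open>Y\<close> modulo \<open>Q\<close> and must be zero. The relation
  is therefore divisible by \<open>f\<close>, and as \<open>P\<close> is prime and misses \<open>f\<close>, the quotient is a relation of
  smaller degree in \<open>f\<close>. This is why the transcendence degree of the residue ring drops strictly
  along a chain of primes.\<close>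
lemma alg_indep_mod_insert:
  assumes P: "primeideal P (mpoly_ring I)" and Q: "ideal Q (mpoly_ring I)" and PQ: "P \<subseteq> Q"
    and Y: "Y \<subseteq> carrier (mpoly_ring I)" "alg_indep_mod Q Y"
    and f: "f \<in> Q" "f \<notin> P"
  shows "f \<notin> Y" "alg_indep_mod P (insert f Y)"
proof -
  interpret P: primeideal P "mpoly_ring I" by (rule P)
  interpret Q: ideal Q "mpoly_ring I" by (rule Q)
  have fc: "f \<in> carrier (mpoly_ring I)" using f(1) Q.a_subset by blast
  have mvar_neq_0: "mvar f \<noteq> (0 :: ((_, _) mpoly, _) mpoly)"
    by (metis mvar_def keys_zero keys_single insert_not_empty zero_neq_one)
  show "f \<notin> Y"
  proof
    assume "f \<in> Y"
    then have "mpoly_subst id (mvar f) \<notin> Q"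
      using Y(2) mvar_neq_0 mpoly_ring_closed(7)[of f Y]
      by (auto simp del: mpoly_ring_simps simp: alg_indep_mod_def)
    with f(1) show False by simp
  qed
  have sub: "insert f Y \<subseteq> carrier (mpoly_ring I)" using Y(1) fc by blast
  have main: "q = 0"
    if "q \<in> carrier (mpoly_ring (insert f Y))" "\<And>m. m \<in> keys q \<Longrightarrow> lookup m f < n"
      "mpoly_subst id q \<in> P" for q n
    using that
  proof (induction n arbitrary: q)
    case 0
    then show ?case using keys_eq_empty by blast
  next
    case (Suc n)
    obtain q0 q1 where q: "q0 \<in> carrier (mpoly_ring Y)" "q1 \<in> carrier (mpoly_ring (insert f Y))"
      "q = q0 + mvar f * q1" "\<And>m. m \<in> keys q1 \<Longrightarrow> lookup m f < n"
      using mpoly_split_variable[OF Suc.prems(1,2)] by blast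
    let ?s = "mpoly_subst id q1"
    have s: "?s \<in> carrier (mpoly_ring I)" by (rule mpoly_subst_id_closed[OF q(2) sub])
    have e: "mpoly_subst id q = mpoly_subst id q0 + f * ?s"
      by (simp add: q(3) mpoly_subst_add mpoly_subst_mult)
    have "- ?s \<in> carrier (mpoly_ring I)" by (rule mpoly_ring_closed(3)[OF s])
    then have "f * - ?s \<in> Q" using Q.I_r_closed[OF f(1)] by (simp only: mpoly_ring_simps(2))
    moreover have "mpoly_subst id q \<in> Q" using Suc.prems(3) PQ by blast
    ultimately have "mpoly_subst id q + f * - ?s \<in> Q" using Q.a_closed by fastforce
    then have "mpoly_subst id q0 \<in> Q" by (simp add: e)
    then have "q0 = 0" using Y(2) q(1) unfolding alg_indep_mod_def by blast
    then have "f * ?s \<in> P" using Suc.prems(3) unfolding e by simp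
    then have "?s \<in> P" using P.I_prime[OF fc s] f(2) by auto
    then have "q1 = 0" using Suc.IH[OF q(2,4)] by blast
    then show ?case using q(3) \<open>q0 = 0\<close> by simp
  qed
  show "alg_indep_mod P (insert f Y)"
    unfolding alg_indep_mod_def
  proof (intro ballI impI notI)
    fix q assume q: "q \<in> carrier (mpoly_ring (insert f Y))" "q \<noteq> 0" "mpoly_subst id q \<in> P"
    have "lookup m f < Suc (Max ((\<lambda>m. lookup m f) ` keys q))" if "m \<in> keys q" for m
      using that by (simp add: less_Suc_eq_le)
    from main[OF q(1) this q(3)] q(2) show False by blast
  qed
qed

text \<open>Descending the chain, each of its \<open>n\<close> steps contributes one new independent element.\<close>
lemma alg_indep_mod_prime_chain:
  assumes c: "\<And>i. i \<le> n \<Longrightarrow> primeideal (c i) (mpoly_ring I)" "\<And>i. i < n \<Longrightarrow> c i \<subset> c (Suc i)"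
    and Y: "finite Y" "Y \<subseteq> carrier (mpoly_ring I)" "alg_indep_mod (c n) Y"
  shows "\<exists>Z. finite Z \<and> Z \<subseteq> carrier (mpoly_ring I) \<and> card Z = card Y + n \<and> alg_indep_mod (c 0) Z"
proof -
  have "\<exists>Z. finite Z \<and> Z \<subseteq> carrier (mpoly_ring I) \<and> card Z = card Y + k \<and>
      alg_indep_mod (c (n - k)) Z" if "k \<le> n" for k
    using that
  proof (induction k)
    case 0
    then show ?case using Y by auto
  next
    case (Suc k)
    then obtain Z where Z: "finite Z" "Z \<subseteq> carrier (mpoly_ring I)" "card Z = card Y + k"
      "alg_indep_mod (c (n - k)) Z" by auto
    let ?i = "n - Suc k"
    have i: "Suc ?i = n - k" using Suc.prems by simp
    have "c ?i \<subset> c (Suc ?i)" using c(2)[of ?i] Suc.prems by simp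
    then obtain f where f: "f \<in> c (n - k)" "f \<notin> c ?i" and sub: "c ?i \<subseteq> c (n - k)"
      unfolding i by blast
    have Q: "ideal (c (n - k)) (mpoly_ring I)"
      using c(1)[of "n - k"] by (simp add: primeideal_def)
    note ins = alg_indep_mod_insert[OF c(1) Q sub Z(2,4) f]
    have "f \<in> carrier (mpoly_ring I)"
      using f(1) Q additive_subgroup.a_subset ideal.axioms(1) by blast
    then show ?case
      using ins Z by (intro exI[of _ "insert f Z"]) (auto simp del: mpoly_ring_simps)
  qed
  from this[of n] show ?thesis by simp
qed

definition exponent_box :: "'x set \<Rightarrow> nat \<Rightarrow> ('x \<Rightarrow>\<^sub>0 nat) set" where
  "exponent_box J n = {m. keys m \<subseteq> J \<and> (\<forall>i. lookup m i \<le> n)}"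

lemma card_exponent_box:
  assumes "finite J"
  shows "finite (exponent_box J n)" "card (exponent_box J n) = Suc n ^ card J"
proof -
  have "bij_betw (\<lambda>m. restrict (lookup m) J) (exponent_box J n) (PiE J (\<lambda>_. {..n}))"
  proof (rule bij_betwI')
    show "restrict (lookup a) J = restrict (lookup b) J \<longleftrightarrow> a = b"
      if "a \<in> exponent_box J n" "b \<in> exponent_box J n" for a b
    proof
      assume eq: "restrict (lookup a) J = restrict (lookup b) J"
      show "a = b"
      proof (rule poly_mapping_eqI)
        fix i
        show "lookup a i = lookup b i"
        proof (cases "i \<in> J")
          case True
          then show ?thesis using fun_cong[OF eq, of i] by simp
        next
          case False
          then have "i \<notin> keys a" "i \<notin> keys b" using that by (auto simp: exponent_box_def)
          then show ?thesis by (simp add: in_keys_iff)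
        qed
      qed
    qed simp
    show "restrict (lookup m) J \<in> PiE J (\<lambda>_. {..n})" if "m \<in> exponent_box J n" for m
      using that by (auto simp: exponent_box_def)
    show "\<exists>m\<in>exponent_box J n. f = restrict (lookup m) J" if f: "f \<in> PiE J (\<lambda>_. {..n})" for f
    proof -
      let ?m = "Abs_poly_mapping (\<lambda>i. if i \<in> J then f i else 0)"
      have "lookup ?m = (\<lambda>i. if i \<in> J then f i else 0)"
        by (rule lookup_Abs_poly_mapping) (use assms in auto)
      moreover from this have "f = restrict (lookup ?m) J"
        using f by (auto simp: PiE_def extensional_def fun_eq_iff)
      moreover have "?m \<in> exponent_box J n"
        unfolding exponent_box_def using f calculation(1)
        by (auto simp: in_keys_iff Pi_iff split: if_splits)
      ultimately show ?thesis by blast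
    qed
  qed
  note bij = this
  show "finite (exponent_box J n)"
    using bij_betw_finite[OF bij] assms by (simp add: finite_PiE)
  show "card (exponent_box J n) = Suc n ^ card J"
    using bij_betw_same_card[OF bij] assms by (simp add: card_PiE)
qed

lemma exponent_box_mono: "a \<le> b \<Longrightarrow> exponent_box J a \<subseteq> exponent_box J b"
  unfolding exponent_box_def by (auto intro: order_trans)

lemma keys_mult_exponent_box:
  assumes "keys p \<subseteq> exponent_box J a" "keys q \<subseteq> exponent_box J b"
  shows "keys (p * q) \<subseteq> exponent_box J (a + b)"
proof
  fix m assume "m \<in> keys (p * q)"
  then obtain x y where xy: "m = x + y" "x \<in> keys p" "y \<in> keys q"
    using Poly_Mapping.keys_mult[of p q] by auto
  then have "x \<in> exponent_box J a" "y \<in> exponent_box J b" using assms by auto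
  then show "m \<in> exponent_box J (a + b)"
    using Poly_Mapping.keys_add[of x y] unfolding xy(1) exponent_box_def
    by (auto simp: lookup_add add_mono)
qed

lemma keys_power_exponent_box:
  fixes p :: "('x, 'k::field) mpoly"
  assumes "keys p \<subseteq> exponent_box J a"
  shows "keys (p ^ n) \<subseteq> exponent_box J (n * a)"
proof (induction n)
  case 0
  then show ?case by (simp add: exponent_box_def)
next
  case (Suc n)
  then show ?case using keys_mult_exponent_box[OF assms Suc] by simp
qed

lemma keys_prod_exponent_box:
  fixes p :: "'i \<Rightarrow> ('x, 'k::field) mpoly"
  assumes "\<And>i. i \<in> A \<Longrightarrow> keys (p i) \<subseteq> exponent_box J (a i)"
  shows "keys (\<Prod>i\<in>A. p i) \<subseteq> exponent_box J (\<Sum>i\<in>A. a i)"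
  using assms
proof (induction A rule: infinite_finite_induct)
  case (insert i A)
  then show ?case using keys_mult_exponent_box[of "p i" J "a i" "\<Prod>i\<in>A. p i"] by simp
qed (simp_all add: exponent_box_def)

lemma lookup_mconst_mult: "lookup (mconst c * p) m = c * lookup p m"
proof -
  have "mconst c * p = Poly_Mapping.map ((*) c) p"
    by (simp add: mconst_def mult_map_scale_conv_mult)
  then show ?thesis by (simp add: Poly_Mapping.map.rep_eq when_def)
qed

text \<open>Dimension count: the products of the elements of \<open>Y\<close> with exponents at most \<open>M\<close> number
  \<open>(M + 1)\<close> to the power \<open>card Y\<close>, while they live in a space whose dimension grows like \<open>M\<close> to the
  power \<open>card I\<close>. If \<open>card Y\<close> were larger, these products would be linearly dependent for large \<open>M\<close>.\<close>
lemma alg_indep_mod_card_le: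
  fixes Y :: "('x, 'k::field) mpoly set"
  assumes I: "finite I" and Y: "finite Y" "Y \<subseteq> carrier (mpoly_ring I)"
    and ind: "alg_indep_mod P Y" and P: "0 \<in> P"
  shows "card Y \<le> card I"
proof (rule ccontr)
  assume "\<not> card Y \<le> card I"
  then have less: "Suc (card I) \<le> card Y" by simp
  have "\<exists>D. \<forall>y\<in>Y. keys y \<subseteq> exponent_box I D"
  proof -
    let ?S = "(\<lambda>(m, i). lookup m i) ` ((\<Union>y\<in>Y. keys y) \<times> I)"
    have fin: "finite ?S" using I Y(1) by simp
    have "lookup m i \<le> Max ?S" if "y \<in> Y" "m \<in> keys y" for y m i
    proof (cases "i \<in> I")
      case True
      then show ?thesis using that by (intro Max_ge[OF fin]) force
    next
      case False
      have "y \<in> carrier (mpoly_ring I)" using that Y(2) by blast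
      then have "keys m \<subseteq> I" using that by simp
      then have "i \<notin> keys m" using False by blast
      then show ?thesis by (simp add: in_keys_iff)
    qed
    then show ?thesis
      using Y(2) by (intro exI[of _ "Max ?S"]) (auto simp: exponent_box_def subset_iff)
  qed
  then obtain D where D: "\<And>y. y \<in> Y \<Longrightarrow> keys y \<subseteq> exponent_box I D" by blast
  \<comment> \<open>The products have exponents at most \<open>M * K\<close>, and \<open>M * K + 1\<close> is at most \<open>(M + 1) * (K + 1)\<close>;
    this value of \<open>M\<close> absorbs the power of \<open>K + 1\<close>.\<close>
  define K where "K = card Y * D"
  define M where "M = Suc K ^ card I"
  let ?A = "exponent_box Y M" and ?B = "exponent_box I (M * K)"
  let ?c = "\<lambda>n. \<Prod>y\<in>keys n. y ^ lookup n y"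
  have keys_c: "keys (?c n) \<subseteq> ?B" if n: "n \<in> ?A" for n
  proof -
    have "keys (?c n) \<subseteq> exponent_box I (\<Sum>y\<in>keys n. lookup n y * D)"
      by (intro keys_prod_exponent_box keys_power_exponent_box D)
        (use n in \<open>auto simp: exponent_box_def\<close>)
    moreover have "(\<Sum>y\<in>keys n. lookup n y * D) \<le> (\<Sum>y\<in>keys n. M * D)"
      using n by (intro sum_mono mult_right_mono) (auto simp: exponent_box_def)
    moreover have "\<dots> \<le> M * K"
    proof -
      have "card (keys n) \<le> card Y"
        using n Y(1) by (intro card_mono) (auto simp: exponent_box_def)
      then show ?thesis by (simp add: K_def mult.commute mult.left_commute)
    qed
    ultimately show ?thesis using exponent_box_mono by (meson order_trans)
  qed
  have "card ?B = Suc (M * K) ^ card I" by (rule card_exponent_box(2)[OF I])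
  also have "\<dots> \<le> (Suc M * Suc K) ^ card I" by (rule power_mono) auto
  also have "\<dots> = Suc M ^ card I * M" by (simp only: power_mult_distrib M_def[symmetric])
  also have "\<dots> < Suc M ^ card I * Suc M" by simp
  also have "\<dots> = Suc M ^ Suc (card I)" by simp
  also have "\<dots> \<le> Suc M ^ card Y" by (rule power_increasing[OF less]) simp
  also have "\<dots> = card ?A" by (rule card_exponent_box(2)[OF Y(1), symmetric])
  finally obtain l where l: "\<exists>n\<in>?A. l n \<noteq> 0" "\<forall>b\<in>?B. (\<Sum>n\<in>?A. l n * lookup (?c n) b) = 0"
    using underdetermined_system[of ?B ?A "\<lambda>n b. lookup (?c n) b"]
      card_exponent_box(1)[OF I] card_exponent_box(1)[OF Y(1)] by blast
  define q where "q = (\<Sum>n\<in>?A. single n (l n))"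
  have "q \<in> carrier (mpoly_ring Y)"
    unfolding q_def by (intro carrier_mpoly_ring_sum carrier_mpoly_ring_single)
      (auto simp: exponent_box_def)
  moreover have "q \<noteq> 0"
  proof -
    from l(1) obtain n where n: "n \<in> ?A" "l n \<noteq> 0" by blast
    have "lookup q n = l n"
      using n card_exponent_box(1)[OF Y(1)] by (simp add: q_def lookup_sum lookup_single when_def)
    then show ?thesis using n by auto
  qed
  moreover have "mpoly_subst id q = 0"
  proof (rule poly_mapping_eqI)
    fix b
    have "lookup (mpoly_subst id q) b = (\<Sum>n\<in>?A. l n * lookup (?c n) b)"
      by (simp add: q_def mpoly_subst_sum mpoly_subst_single lookup_sum lookup_mconst_mult)
    also have "\<dots> = 0"
    proof (cases "b \<in> ?B")
      case False
      have "lookup (?c n) b = 0" if "n \<in> ?A" for n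
      proof -
        have "b \<notin> keys (?c n)" using keys_c[OF that] False by (rule contra_subsetD)
        then show ?thesis by (simp only: in_keys_iff not_not)
      qed
      then show ?thesis by (intro sum.neutral ballI) (simp only: mult_zero_right)
    next
      case True
      show ?thesis by (rule bspec[OF l(2) True])
    qed
    finally show "lookup (mpoly_subst id q) b = lookup 0 b" by simp
  qed
  ultimately show False using ind P unfolding alg_indep_mod_def by auto
qed

lemma prime_height_le:
  assumes I: "finite I" and Y: "finite Y" "Y \<subseteq> carrier (mpoly_ring I)" "alg_indep_mod P Y"
  shows "prime_height (mpoly_ring I) P \<le> enat (card I - card Y)"
  unfolding prime_height_def
proof (rule Sup_least, clarify)
  fix n and c :: "nat \<Rightarrow> _"
  assume c: "P = c n" "\<forall>i\<le>n. primeideal (c i) (mpoly_ring I)" "\<forall>i<n. c i \<subset> c (Suc i)"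
  obtain Z where Z: "finite Z" "Z \<subseteq> carrier (mpoly_ring I)" "card Z = card Y + n"
    "alg_indep_mod (c 0) Z"
    using alg_indep_mod_prime_chain[of n c I Y] c Y by auto
  have "ideal (c 0) (mpoly_ring I)" using c(2) by (simp add: primeideal_def)
  then have "0 \<in> c 0"
    using additive_subgroup.zero_closed ideal.axioms(1) by fastforce
  then have "card Z \<le> card I" by (rule alg_indep_mod_card_le[OF I Z(1,2,4)])
  then show "enat n \<le> enat (card I - card Y)" using Z(3) by simp
qed

section \<open>The toric ideal and its height\<close>

definition edge_deg :: "'v set \<Rightarrow> 'v \<Rightarrow>\<^sub>0 nat" where
  "edge_deg e = (\<Sum>v\<in>e. single v 1)"

abbreviation mdeg :: "('v set \<Rightarrow>\<^sub>0 nat) \<Rightarrow> ('v \<Rightarrow>\<^sub>0 nat)" where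
  "mdeg \<equiv> mon_map edge_deg"

lemma lookup_edge_deg: "finite e \<Longrightarrow> lookup (edge_deg e) v = of_bool (v \<in> e)"
  by (simp add: edge_deg_def lookup_sum lookup_single when_def of_bool_def)

lemma prod_mvar_edge: "(\<Prod>v\<in>e. mvar v) = single (edge_deg e) (1::'k::field)"
  by (simp add: mvar_def prod_single edge_deg_def)

definition coeff_sum :: "('x \<Rightarrow>\<^sub>0 nat) set \<Rightarrow> ('x, 'k::field) mpoly \<Rightarrow> 'k" where
  "coeff_sum A p = (\<Sum>m\<in>{m \<in> keys p. m \<in> A}. lookup p m)"

lemma coeff_sum_superset:
  assumes "finite M" "keys p \<subseteq> M"
  shows "coeff_sum A p = (\<Sum>m\<in>M. if m \<in> A then lookup p m else 0)"
proof -
  have "coeff_sum A p = (\<Sum>m\<in>keys p. if m \<in> A then lookup p m else 0)"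
    by (simp add: coeff_sum_def sum.inter_filter)
  also have "\<dots> = (\<Sum>m\<in>M. if m \<in> A then lookup p m else 0)"
    by (rule sum.mono_neutral_left) (use assms in \<open>auto simp: in_keys_iff\<close>)
  finally show ?thesis .
qed

lemma coeff_sum_add: "coeff_sum A (p + q) = coeff_sum A p + coeff_sum A q"
proof -
  let ?M = "keys p \<union> keys q"
  have "keys (p + q) \<subseteq> ?M" by (rule Poly_Mapping.keys_add)
  then show ?thesis
    by (simp add: coeff_sum_superset[of ?M] lookup_add flip: sum.distrib cong: if_cong)
      (rule sum.cong, auto)
qed

lemma coeff_sum_0 [simp]: "coeff_sum A 0 = 0"
  by (simp add: coeff_sum_def)

lemma coeff_sum_sum: "coeff_sum A (\<Sum>i\<in>I. p i) = (\<Sum>i\<in>I. coeff_sum A (p i))"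
  by (induction I rule: infinite_finite_induct) (simp_all add: coeff_sum_add)

lemma coeff_sum_uminus: "coeff_sum A (- p) = - coeff_sum A p"
  using coeff_sum_add[of A p "- p"] by (simp add: eq_neg_iff_add_eq_0 add.commute)

lemma coeff_sum_single: "coeff_sum A (single m c) = (if m \<in> A then c else 0)"
  by (simp add: coeff_sum_superset[of "{m}"])

lemma coeff_sum_cong:
  "(\<And>m. m \<in> keys p \<Longrightarrow> m \<in> A \<longleftrightarrow> m \<in> B) \<Longrightarrow> coeff_sum A p = coeff_sum B p"
  unfolding coeff_sum_def by (rule sum.cong) auto

lemma coeff_sum_mult:
  "coeff_sum A (q * p) = (\<Sum>n\<in>keys q. lookup q n * coeff_sum {m. n + m \<in> A} p)"
proof -
  have "q * p = (\<Sum>n\<in>keys q. single n (lookup q n)) * (\<Sum>m\<in>keys p. single m (lookup p m))"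
    by (rule arg_cong2[of _ _ _ _ "(*)", OF poly_mapping_sum_single poly_mapping_sum_single])
  then have "q * p = (\<Sum>n\<in>keys q. \<Sum>m\<in>keys p. single (n + m) (lookup q n * lookup p m))"
    by (simp only: sum_product mult_single)
  then have "coeff_sum A (q * p) =
      (\<Sum>n\<in>keys q. \<Sum>m\<in>keys p. if n + m \<in> A then lookup q n * lookup p m else 0)"
    by (simp add: coeff_sum_sum coeff_sum_single)
  also have "\<dots> = (\<Sum>n\<in>keys q. lookup q n * coeff_sum {m. n + m \<in> A} p)"
    by (rule sum.cong)
      (simp_all add: coeff_sum_superset[of "keys p"] sum_distrib_left if_distrib cong: if_cong)
  finally show ?thesis .
qed

text \<open>Linear independence over the rationals of the incidence vectors of the edges in \<open>F\<close>, with
  denominators cleared: this is algebraic independence of the monomials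
  \<open>t\<^sub>u t\<^sub>v\<close>, so the largest such \<open>F\<close> has the dimension of the edge ring as its size.\<close>
definition independent_edges :: "'v set set \<Rightarrow> bool" where
  "independent_edges F \<longleftrightarrow>
     (\<forall>l :: 'v set \<Rightarrow> int. (\<forall>v. (\<Sum>e\<in>F. l e * of_bool (v \<in> e)) = 0) \<longrightarrow> (\<forall>e\<in>F. l e = 0))"

lemma mvar_inject: "mvar x = (mvar y :: ('x, 'k::field) mpoly) \<longleftrightarrow> x = y"
  by (metis keys_single lookup_single_eq lookup_single_not_eq mvar_def singleton_inject zero_neq_one)

locale finite_simple_graph =
  fixes V :: "'v set" and E :: "'v set set"
  assumes simple_graph: "simple_graph V E"
begin

lemma finite_V: "finite V" and edge_subset: "e \<in> E \<Longrightarrow> e \<subseteq> V" and card_edge: "e \<in> E \<Longrightarrow> card e = 2"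
  using simple_graph by (auto simp: simple_graph_def)

lemma finite_edge: "e \<in> E \<Longrightarrow> finite e"
  using edge_subset finite_V finite_subset by blast

lemma finite_E: "finite E"
  by (rule finite_subset[of _ "Pow V"]) (use edge_subset finite_V in auto)

lemma lookup_mdeg:
  assumes "keys m \<subseteq> E"
  shows "lookup (mdeg m) v = (\<Sum>e\<in>E. lookup m e * of_bool (v \<in> e))"
  unfolding lookup_mon_map_superset[OF finite_E assms]
  by (rule sum.cong) (simp_all add: lookup_edge_deg finite_edge)

abbreviation toric :: "('v set, 'k::field) mpoly set" where
  "toric \<equiv> toric_ideal V E"

lemma toric_iff:
  "p \<in> (toric :: ('v set, 'k::field) mpoly set) \<longleftrightarrow>
     p \<in> carrier (mpoly_ring E) \<and> mpoly_subst (\<lambda>e. single (edge_deg e) 1) p = 0"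
  by (simp add: toric_ideal_def a_kernel_def' prod_mvar_edge del: mpoly_ring_simps(1))

text \<open>Two monomials have the same image iff they have the same degree in \<open>\<nat>\<close> to the power \<open>V\<close>; so \<open>p\<close> lies
  in the toric ideal iff its coefficients sum to zero over every fibre of the degree map.\<close>
lemma toric_iff_coeff_sum:
  "p \<in> (toric :: ('v set, 'k::field) mpoly set) \<longleftrightarrow>
     p \<in> carrier (mpoly_ring E) \<and> (\<forall>d. coeff_sum {m. mdeg m = d} p = 0)"
proof -
  have "mpoly_subst (\<lambda>e. single (edge_deg e) 1) p = 0 \<longleftrightarrow> (\<forall>d. coeff_sum {m. mdeg m = d} p = 0)"
    if "p \<in> carrier (mpoly_ring E)"
    by (simp add: poly_mapping_eq_iff fun_eq_iff coeff_sum_def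
        lookup_mpoly_subst_monomials[OF that refl] del: mpoly_ring_simps(1))
  then show ?thesis unfolding toric_iff by blast
qed

lemma toric_hom:
  "mpoly_subst (\<lambda>e. single (edge_deg e) (1::'k::field)) \<in> ring_hom (mpoly_ring E) (mpoly_ring V)"
proof (rule mpoly_subst_ring_hom)
  fix e assume "e \<in> E"
  then have "keys (edge_deg e) \<subseteq> V"
    using edge_subset by (force simp: in_keys_iff lookup_edge_deg finite_edge)
  then show "single (edge_deg e) (1::'k) \<in> carrier (mpoly_ring V)" by simp
qed

lemma toric_ideal_ideal: "ideal (toric :: ('v set, 'k::field) mpoly set) (mpoly_ring E)"
proof -
  interpret E: cring "mpoly_ring E :: ('v set, 'k) mpoly ring" by (rule cring_mpoly_ring)
  interpret V: cring "mpoly_ring V :: ('v, 'k) mpoly ring" by (rule cring_mpoly_ring)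
  have "ring_hom_ring (mpoly_ring E) (mpoly_ring V) (mpoly_subst (\<lambda>e. single (edge_deg e) (1::'k)))"
    by (rule ring_hom_ringI2[OF E.ring_axioms V.ring_axioms toric_hom])
  from ring_hom_ring.kernel_is_ideal[OF this] show ?thesis
    by (simp add: toric_ideal_def prod_mvar_edge)
qed

lemma toric_ideal_prime: "primeideal (toric :: ('v set, 'k::field) mpoly set) (mpoly_ring E)"
proof (rule primeidealI[OF toric_ideal_ideal cring_mpoly_ring])
  let ?h = "mpoly_subst (\<lambda>e. single (edge_deg e) (1::'k))"
  have "(1 :: ('v set, 'k) mpoly) \<in> carrier (mpoly_ring E)" by (rule mpoly_ring_closed)
  moreover have "(1 :: ('v set, 'k) mpoly) \<notin> toric" by (simp add: toric_iff)
  ultimately show "carrier (mpoly_ring E) \<noteq> (toric :: ('v set, 'k) mpoly set)" by blast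
  fix a b :: "('v set, 'k) mpoly"
  assume ab: "a \<in> carrier (mpoly_ring E)" "b \<in> carrier (mpoly_ring E)"
    "a \<otimes>\<^bsub>mpoly_ring E\<^esub> b \<in> toric"
  then have "?h a * ?h b = 0" by (simp add: toric_iff mpoly_subst_mult)
  moreover have "?h a \<in> carrier (mpoly_ring V)" "?h b \<in> carrier (mpoly_ring V)"
    using ab(1,2) ring_hom_closed[OF toric_hom] by blast+
  ultimately have "?h a = 0 \<or> ?h b = 0" by (rule mult_eq_0_imp_eq_0_mpoly[OF finite_V, rotated 2])
  then show "a \<in> toric \<or> b \<in> toric" using ab(1,2) unfolding toric_iff by blast
qed

text \<open>Independence of incidence vectors says exactly that distinct monomials in the edges of \<open>F\<close> have
  distinct degrees.\<close>
lemma independent_edges_alg_indep_mod: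
  assumes F: "F \<subseteq> E" "independent_edges F"
  shows "alg_indep_mod (toric :: ('v set, 'k::field) mpoly set) (mvar ` F)"
  unfolding alg_indep_mod_def
proof (intro ballI impI notI)
  fix q :: "(('v set, 'k) mpoly, 'k) mpoly"
  assume q: "q \<in> carrier (mpoly_ring (mvar ` F))" "q \<noteq> 0" "mpoly_subst id q \<in> toric"
  let ?h = "mpoly_subst (\<lambda>e. single (edge_deg e) (1::'k))"
  have finF: "finite F" using F(1) finite_E finite_subset by blast
  have inj: "inj_on (mvar :: _ \<Rightarrow> ('v set, 'k) mpoly) F" by (simp add: inj_on_def mvar_inject)
  define g where "g = (\<lambda>y :: ('v set, 'k) mpoly. edge_deg (inv_into F mvar y))"
  have g: "g (mvar e) = edge_deg e" if "e \<in> F" for e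
    using that inj by (simp add: g_def inv_into_f_f)
  have hy: "?h y = single (g y) 1" if "y \<in> mvar ` F" for y using that g by auto
  have "?h (mpoly_subst id q) = 0" using q(3) unfolding toric_iff by blast
  then have q0: "mpoly_subst ?h q = 0" by (simp add: mpoly_subst_comp)
  have look: "lookup (mon_map g m) v = (\<Sum>e\<in>F. lookup m (mvar e) * of_bool (v \<in> e))"
    if "keys m \<subseteq> mvar ` F" for m v
  proof -
    have "lookup (mon_map g m) v = (\<Sum>y\<in>mvar ` F. lookup m y * lookup (g y) v)"
      by (rule lookup_mon_map_superset) (use finF that in auto)
    also have "\<dots> = (\<Sum>e\<in>F. lookup m (mvar e) * lookup (g (mvar e)) v)"
      by (simp add: sum.reindex[OF inj])
    also have "\<dots> = (\<Sum>e\<in>F. lookup m (mvar e) * of_bool (v \<in> e))"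
      by (rule sum.cong) (use F(1) in \<open>auto simp: g lookup_edge_deg finite_edge\<close>)
    finally show ?thesis .
  qed
  have "inj_on (mon_map g) {m. keys m \<subseteq> mvar ` F}"
  proof (intro inj_onI poly_mapping_eqI)
    fix m n y
    assume *: "m \<in> {m. keys m \<subseteq> mvar ` F}" "n \<in> {m. keys m \<subseteq> mvar ` F}"
      "mon_map g m = mon_map g n"
    let ?l = "\<lambda>e. int (lookup m (mvar e)) - int (lookup n (mvar e))"
    have "\<forall>v. (\<Sum>e\<in>F. ?l e * of_bool (v \<in> e)) = 0"
    proof
      fix v
      have "(\<Sum>e\<in>F. ?l e * of_bool (v \<in> e))
          = int (lookup (mon_map g m) v) - int (lookup (mon_map g n) v)"
        using *(1,2) by (simp add: look sum_subtractf left_diff_distrib)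
      then show "(\<Sum>e\<in>F. ?l e * of_bool (v \<in> e)) = 0" using *(3) by simp
    qed
    with F(2)[unfolded independent_edges_def, THEN spec, of ?l] have l: "\<forall>e\<in>F. ?l e = 0"
      by (rule mp)
    show "lookup m y = lookup n y"
    proof (cases "y \<in> mvar ` F")
      case True
      then show ?thesis using l by auto
    next
      case False
      then have "y \<notin> keys m" "y \<notin> keys n" using * by auto
      then show ?thesis by (simp add: in_keys_iff)
    qed
  qed
  from mpoly_subst_monomials_inject[OF q(1) hy this q0] q(2) show False by blast
qed

lemma ideal_height_toric_le:
  assumes F: "F \<subseteq> E" "independent_edges F"
  shows "ideal_height (mpoly_ring E) (toric :: ('v set, 'k::field) mpoly set) \<le> enat (card E - card F)"
proof -
  let ?Y = "mvar ` F :: ('v set, 'k) mpoly set"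
  have "ideal_height (mpoly_ring E) (toric :: ('v set, 'k) mpoly set)
      \<le> prime_height (mpoly_ring E) (toric :: ('v set, 'k) mpoly set)"
    unfolding ideal_height_def using toric_ideal_prime by (intro INF_lower) simp
  also have "\<dots> \<le> enat (card E - card ?Y)"
  proof (rule prime_height_le[OF finite_E])
    show "finite ?Y" using F(1) finite_E finite_subset by blast
    show "?Y \<subseteq> carrier (mpoly_ring E)"
      using F(1) by (intro image_subsetI mpoly_ring_closed(7)) (rule subsetD)
  qed (rule independent_edges_alg_indep_mod[OF F])
  also have "card ?Y = card F" by (intro card_image inj_onI) (simp add: mvar_inject)
  finally show ?thesis .
qed

text \<open>The upper bound on the height makes the minimal number of generators finite, hence attained.\<close>
lemma complete_intersection_generators:
  assumes "complete_intersection TYPE('k::field) V E"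
  obtains S :: "('v set, 'k::field) mpoly set"
  where "finite S" "S \<subseteq> carrier (mpoly_ring E)" "Idl\<^bsub>mpoly_ring E\<^esub> S = toric"
    "\<forall>F. F \<subseteq> E \<longrightarrow> independent_edges F \<longrightarrow> card S \<le> card E - card F"
proof -
  let ?P = "toric :: ('v set, 'k) mpoly set"
  let ?G = "{S. finite S \<and> S \<subseteq> carrier (mpoly_ring E) \<and> Idl\<^bsub>mpoly_ring E\<^esub> S = ?P}"
  have le: "min_generators (mpoly_ring E) ?P \<le> enat (card E - card F)"
    if "F \<subseteq> E" "independent_edges F" for F
    using ideal_height_toric_le[OF that, where 'k='k] assms
    unfolding complete_intersection_def by simp
  have "independent_edges {}" by (simp add: independent_edges_def)
  then have "min_generators (mpoly_ring E) ?P \<noteq> \<infinity>" using le[of "{}"] by (intro notI) simp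
  moreover have "min_generators (mpoly_ring E) ?P = \<infinity>" if "?G = {}"
    unfolding min_generators_def that by (simp add: top_enat_def)
  ultimately have "?G \<noteq> {}" by (rule contrapos_nn)
  let ?N = "(\<lambda>S. enat (card S)) ` ?G"
  have ne: "?N \<noteq> {}" using \<open>?G \<noteq> {}\<close> by (simp only: image_is_empty not_False_eq_True)
  then have "Inf ?N = (LEAST n. n \<in> ?N)" unfolding Inf_enat_def by (simp only: if_False)
  moreover have "(LEAST n. n \<in> ?N) \<in> ?N" by (rule LeastI_ex) (rule ex_in_conv[THEN iffD2, OF ne])
  ultimately have "Inf ?N \<in> ?N" by (simp only:)
  then obtain S where S: "S \<in> ?G" "min_generators (mpoly_ring E) ?P = enat (card S)"
    unfolding min_generators_def by (rule imageE)
  show ?thesis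
  proof (rule that)
    show "finite S" "S \<subseteq> carrier (mpoly_ring E)" "Idl\<^bsub>mpoly_ring E\<^esub> S = toric"
      using S(1) by (simp_all only: mem_Collect_eq)
    show "\<forall>F. F \<subseteq> E \<longrightarrow> independent_edges F \<longrightarrow> card S \<le> card E - card F"
      using le unfolding S(2) by simp
  qed
qed

end

section \<open>Fibres, their components and minimal generators\<close>

context finite_simple_graph begin

text \<open>Monomials in one fibre of the degree map are joined when they have a variable \<open>x\<^sub>e\<close> in common. The
  difference of two joined monomials is \<open>x\<^sub>e\<close> times an element of the toric ideal, so it
  vanishes modulo the product of the toric ideal with the maximal ideal of the origin.\<close>
definition edge_sharing :: "(('v set \<Rightarrow>\<^sub>0 nat) \<times> ('v set \<Rightarrow>\<^sub>0 nat)) set" where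
  "edge_sharing = {(a, b). keys a \<subseteq> E \<and> keys b \<subseteq> E \<and> mdeg a = mdeg b \<and> keys a \<inter> keys b \<noteq> {}}"

definition component :: "('v set \<Rightarrow>\<^sub>0 nat) \<Rightarrow> ('v set \<Rightarrow>\<^sub>0 nat) set" where
  "component a = {b. (a, b) \<in> edge_sharing\<^sup>*}"

definition component_rep :: "('v set \<Rightarrow>\<^sub>0 nat) \<Rightarrow> ('v set \<Rightarrow>\<^sub>0 nat)" where
  "component_rep a = (SOME b. b \<in> component a)"

definition fibre_base :: "('v \<Rightarrow>\<^sub>0 nat) \<Rightarrow> ('v set \<Rightarrow>\<^sub>0 nat)" where
  "fibre_base d = component_rep (SOME b. keys b \<subseteq> E \<and> mdeg b = d)"

text \<open>One representative for every component of every fibre, except that each fibre leaves out one of its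
  components. A fibre with \<open>c\<close> components thus contributes \<open>c - 1\<close> elements, the number of minimal
  generators of the toric ideal in that degree; such a generator is the difference of a critical
  monomial and the base monomial of its fibre.\<close>
definition critical :: "('v set \<Rightarrow>\<^sub>0 nat) set" where
  "critical = {a. keys a \<subseteq> E \<and> component_rep a = a \<and> fibre_base (mdeg a) \<noteq> a}"

lemma self_in_component: "a \<in> component a"
  by (simp add: component_def)

lemma component_eq:
  assumes "b \<in> component a"
  shows "component b = component a"
proof -
  have "sym (edge_sharing\<^sup>*)" by (rule sym_rtrancl) (auto simp: sym_def edge_sharing_def)
  with assms have "(a, b) \<in> edge_sharing\<^sup>*" "(b, a) \<in> edge_sharing\<^sup>*"
    by (auto simp: component_def dest: symD)
  then show ?thesis unfolding component_def by (auto intro: rtrancl_trans)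
qed

lemma component_rep_in_component: "component_rep a \<in> component a"
  unfolding component_rep_def by (rule someI[of _ a]) (rule self_in_component)

lemma component_rep_eq: "b \<in> component a \<Longrightarrow> component_rep b = component_rep a"
  by (simp add: component_rep_def component_eq)

lemma component_props:
  assumes "b \<in> component a" "keys a \<subseteq> E"
  shows "keys b \<subseteq> E" "mdeg b = mdeg a"
proof -
  have "(a, b) \<in> edge_sharing\<^sup>*" using assms(1) by (simp add: component_def)
  then have "keys b \<subseteq> E \<and> mdeg b = mdeg a"
    by (induction rule: rtrancl_induct) (use assms(2) in \<open>auto simp: edge_sharing_def\<close>)
  then show "keys b \<subseteq> E" "mdeg b = mdeg a" by blast+
qed

lemma fibre_base_props:
  assumes "keys a \<subseteq> E"
  shows "keys (fibre_base (mdeg a)) \<subseteq> E" "mdeg (fibre_base (mdeg a)) = mdeg a"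
    "component_rep (fibre_base (mdeg a)) = fibre_base (mdeg a)"
proof -
  let ?b = "SOME b. keys b \<subseteq> E \<and> mdeg b = mdeg a"
  have "keys ?b \<subseteq> E \<and> mdeg ?b = mdeg a"
    by (rule someI[of _ a]) (use assms in simp)
  then show "keys (fibre_base (mdeg a)) \<subseteq> E" "mdeg (fibre_base (mdeg a)) = mdeg a"
    "component_rep (fibre_base (mdeg a)) = fibre_base (mdeg a)"
    using component_props[OF component_rep_in_component, of ?b] component_rep_eq[OF component_rep_in_component]
    by (simp_all add: fibre_base_def)
qed

lemma critical_disconnected:
  assumes "a \<in> critical"
  shows "fibre_base (mdeg a) \<notin> component a"
  using assms component_rep_eq[of "fibre_base (mdeg a)" a] fibre_base_props(3)[of a] by (auto simp: critical_def)

lemma in_keys_mdeg: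
  assumes "keys m \<subseteq> E"
  shows "v \<in> keys (mdeg m) \<longleftrightarrow> (\<exists>e\<in>keys m. v \<in> e)"
  using assms finite_E by (auto simp: in_keys_iff lookup_mdeg[OF assms])

lemma edge_other_vertex:
  assumes "e \<in> E" "u \<in> e"
  obtains x where "e = {u, x}" "x \<noteq> u"
  using card_edge[OF assms(1)] assms(2) that by (auto simp: card_2_iff)

lemma keys_mdeg_subset: "keys m \<subseteq> E \<Longrightarrow> keys (mdeg m) \<subseteq> V"
  using edge_subset by (intro subsetI) (unfold in_keys_mdeg, blast)

text \<open>A critical monomial \<open>a\<close> and the base monomial \<open>b\<close> of its fibre have no edge in common but cover the
  same vertices. If \<open>a\<close> contains \<open>{u, w}\<close>, then \<open>b\<close> leaves \<open>u\<close> and \<open>w\<close> along other edges; should these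
  meet in one vertex \<open>x\<close>, then \<open>a\<close> has to leave \<open>x\<close> towards a fourth vertex.\<close>
lemma four_vertices_of_critical:
  assumes a: "a \<in> critical"
  shows "4 \<le> card (keys (mdeg a))"
proof -
  define b where "b = fibre_base (mdeg a)"
  have aE: "keys a \<subseteq> E" and bE: "keys b \<subseteq> E" and deg: "mdeg b = mdeg a" and "b \<noteq> a"
    using a fibre_base_props by (auto simp: critical_def b_def)
  have disj: "keys a \<inter> keys b = {}"
  proof (rule ccontr)
    assume "keys a \<inter> keys b \<noteq> {}"
    then have "b \<in> component a"
      using aE bE deg by (auto simp: component_def edge_sharing_def)
    then show False using critical_disconnected[OF a] by (simp add: b_def)
  qed
  note ka = in_keys_mdeg[OF aE] and kb = in_keys_mdeg[OF bE, unfolded deg]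
  have nonempty: "\<exists>v. v \<in> e" if "e \<in> E" for e
    using card_edge[OF that] by (auto simp: card_2_iff)
  have "keys a \<noteq> {}"
  proof
    assume "keys a = {}"
    then have no: "v \<notin> keys (mdeg a)" for v using ka by simp
    have "e \<notin> keys b" for e
    proof
      assume e: "e \<in> keys b"
      then obtain v where "v \<in> e" using nonempty bE by blast
      then show False using e no[of v] unfolding kb by blast
    qed
    then have "keys b = {}" by blast
    with \<open>keys a = {}\<close> \<open>b \<noteq> a\<close> show False by simp
  qed
  then obtain e u where e: "e \<in> keys a" "u \<in> e" using nonempty aE by blast
  then obtain w where w: "e = {u, w}" "w \<noteq> u" using edge_other_vertex aE by blast
  have uw: "u \<in> keys (mdeg a)" "w \<in> keys (mdeg a)" using e w ka by auto
  have at: "\<exists>e x. e \<in> keys m \<and> e = {v, x} \<and> x \<noteq> v"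
    if m: "keys m \<subseteq> E" and v: "v \<in> keys (mdeg m)" for m v
  proof -
    from v obtain e where e: "e \<in> keys m" "v \<in> e" unfolding in_keys_mdeg[OF m] by (rule bexE)
    obtain x where "e = {v, x}" "x \<noteq> v" by (rule edge_other_vertex[OF subsetD[OF m e(1)] e(2)])
    then show ?thesis using e(1) by blast
  qed
  obtain e1 x where x: "e1 \<in> keys b" "e1 = {u, x}" "x \<noteq> u"
    using at[OF bE, of u] uw(1) deg by auto
  obtain e2 y where y: "e2 \<in> keys b" "e2 = {w, y}" "y \<noteq> w"
    using at[OF bE, of w] uw(2) deg by auto
  have xy: "x \<in> keys (mdeg a)" "y \<in> keys (mdeg a)" using x y kb by auto
  have "e \<notin> keys b" using disj e(1) by blast
  then have "x \<noteq> w" "y \<noteq> u" using w x(1,2) y(1,2) by (auto simp: insert_commute)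
  have four: "4 \<le> card (keys (mdeg a))"
    if "{p, q, r, s} \<subseteq> keys (mdeg a)" "distinct [p, q, r, s]" for p q r s
    using card_mono[OF _ that(1)] that(2) by simp
  show ?thesis
  proof (cases "x = y")
    case False
    then show ?thesis using four[of u w x y] uw xy x y w \<open>x \<noteq> w\<close> \<open>y \<noteq> u\<close> by auto
  next
    case True
    obtain e3 z where z: "e3 \<in> keys a" "e3 = {x, z}" "z \<noteq> x"
      using at[OF aE xy(1)] by auto
    have "e3 \<notin> keys b" using disj z(1) by blast
    then have "z \<noteq> u" "z \<noteq> w" using z(2) x(1,2) y(1,2) True by (auto simp: insert_commute)
    moreover have "z \<in> keys (mdeg a)" using z ka by auto
    ultimately show ?thesis using four[of u w x z] uw xy x w z \<open>x \<noteq> w\<close> by auto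
  qed
qed

text \<open>The critical pairs generate the congruence of having equal degree: here a congruence is given as the
  kernel of a map \<open>h\<close>. Joined monomials have a common variable, which can be cancelled, so the
  induction on the degree applies to them; distinct components of a fibre are linked by critical pairs.\<close>
lemma critical_pairs_generate:
  assumes h: "\<And>e m n. e \<in> E \<Longrightarrow> keys m \<subseteq> E \<Longrightarrow> keys n \<subseteq> E \<Longrightarrow> h m = h n \<Longrightarrow>
      h (single e 1 + m) = h (single e 1 + n)"
    and crit: "\<And>a. a \<in> critical \<Longrightarrow> h a = h (fibre_base (mdeg a))"
    and "keys a \<subseteq> E" "keys b \<subseteq> E" "mdeg a = mdeg b"
  shows "h a = h b"
proof -
  define size_of where "size_of = (\<lambda>d :: 'v \<Rightarrow>\<^sub>0 nat. \<Sum>v\<in>V. lookup d v)"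
  show ?thesis using assms(3-)
  proof (induction "size_of (mdeg a)" arbitrary: a b rule: less_induct)
    case less
    have step: "h x = h y" if xy: "(x, y) \<in> edge_sharing" "mdeg x = mdeg a" for x y
    proof -
      obtain e where e: "e \<in> keys x" "e \<in> keys y" using xy(1) by (auto simp: edge_sharing_def)
      have xE: "keys x \<subseteq> E" and yE: "keys y \<subseteq> E" and deg: "mdeg x = mdeg y"
        using xy(1) by (auto simp: edge_sharing_def)
      have eE: "e \<in> E" using e xE by blast
      have split: "single e 1 + (m - single e 1) = m" if "e \<in> keys m" for m :: "'v set \<Rightarrow>\<^sub>0 nat"
      proof (rule poly_mapping_eqI)
        have "1 \<le> lookup m e" using that by (simp add: in_keys_iff Suc_le_eq)
        then show "lookup (single e 1 + (m - single e 1)) f = lookup m f" for f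
          by (auto simp: lookup_add lookup_minus lookup_single when_def)
      qed
      have sub: "keys (m - single e 1) \<subseteq> keys m" for m :: "'v set \<Rightarrow>\<^sub>0 nat"
        by (rule subsetI) (simp add: in_keys_iff lookup_minus)
      let ?x = "x - single e 1" and ?y = "y - single e 1"
      have dx: "edge_deg e + mdeg ?x = mdeg x" and dy: "edge_deg e + mdeg ?y = mdeg y"
        using arg_cong[OF split[OF e(1)], of mdeg] arg_cong[OF split[OF e(2)], of mdeg]
        by (simp_all only: mon_map_add mon_map_single)
      have "mdeg ?x = mdeg ?y" using dx dy deg by (metis add_left_cancel)
      moreover have "size_of (mdeg ?x) < size_of (mdeg a)"
      proof -
        obtain v where v: "v \<in> e" using card_edge[OF eE] by (auto simp: card_2_iff)
        then have "v \<in> V" using edge_subset[OF eE] by blast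
        moreover have "lookup (mdeg ?x) v < lookup (mdeg a) v"
          using v by (simp add: xy(2)[symmetric] dx[symmetric] lookup_add
              lookup_edge_deg[OF finite_edge[OF eE]])
        moreover have "lookup (mdeg ?x) w \<le> lookup (mdeg a) w" for w
          by (simp add: xy(2)[symmetric] dx[symmetric] lookup_add)
        ultimately show ?thesis
          unfolding size_of_def using finite_V by (intro sum_strict_mono_ex1) auto
      qed
      moreover have "keys ?x \<subseteq> E" "keys ?y \<subseteq> E" using sub xE yE by blast+
      ultimately have "h ?x = h ?y" by (intro less.hyps) auto
      from h[OF eE \<open>keys ?x \<subseteq> E\<close> \<open>keys ?y \<subseteq> E\<close> this] show ?thesis
        by (simp only: split[OF e(1)] split[OF e(2)])
    qed
    have conn: "h y = h x" if "y \<in> component x" "keys x \<subseteq> E" "mdeg x = mdeg a" for x y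
    proof -
      have "(x, y) \<in> edge_sharing\<^sup>*" using that(1) by (simp add: component_def)
      then show ?thesis
      proof (induction rule: rtrancl_induct)
        case (step y z)
        have "y \<in> component x" using step(1) by (simp add: component_def)
        then have "mdeg y = mdeg a" using component_props(2)[OF _ that(2)] that(3) by simp
        then show ?case using \<open>\<And>x y. (x, y) \<in> edge_sharing \<Longrightarrow> mdeg x = mdeg a \<Longrightarrow> h x = h y\<close> step by metis
      qed simp
    qed
    have "h x = h (fibre_base (mdeg a))" if x: "keys x \<subseteq> E" "mdeg x = mdeg a" for x
    proof -
      have r: "h (component_rep x) = h x" by (rule conn[OF component_rep_in_component x])
      note rx = component_props[OF component_rep_in_component x(1)]
      show ?thesis
      proof (cases "component_rep x = fibre_base (mdeg a)")
        case False
        then have "component_rep x \<in> critical"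
          using rx x(2) component_rep_eq[OF component_rep_in_component] by (auto simp: critical_def)
        from crit[OF this] r show ?thesis by (simp add: rx(2) x(2))
      qed (use r in simp)
    qed
    then show ?case using less.prems by metis
  qed
qed

text \<open>Multiplication by \<open>x\<^sub>e\<close> moves a fibre into a single component of another fibre, and the
  coefficients of \<open>p\<close> sum to zero over every fibre; so only the constant term of \<open>q\<close> contributes.\<close>
lemma coeff_sum_component_mult:
  assumes p: "p \<in> (toric :: ('v set, 'k::field) mpoly set)"
    and q: "q \<in> carrier (mpoly_ring E)" and a: "keys a \<subseteq> E"
  shows "coeff_sum (component a) (q * p) = lookup q 0 * coeff_sum (component a) p"
proof -
  have pE: "keys m \<subseteq> E" if "m \<in> keys p" for m
    using p that by (auto simp: toric_iff)
  have zero: "coeff_sum {m. n + m \<in> component a} p = 0" if n: "n \<in> keys q" "n \<noteq> 0" for n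
  proof (cases "\<exists>m0\<in>keys p. n + m0 \<in> component a")
    case False
    then have "{m \<in> keys p. m \<in> {m. n + m \<in> component a}} = {}" by blast
    then show ?thesis unfolding coeff_sum_def by (simp only: sum.empty)
  next
    case True
    then obtain m0 where m0: "m0 \<in> keys p" "n + m0 \<in> component a" by blast
    have keys_plus: "keys (n + m) = keys n \<union> keys m" for m
      by (auto simp: in_keys_iff lookup_add)
    have nE: "keys n \<subseteq> E" using q n(1) by simp
    have "n + m \<in> component a \<longleftrightarrow> mdeg m = mdeg m0" if m: "m \<in> keys p" for m
    proof
      assume "n + m \<in> component a"
      then have "mdeg (n + m) = mdeg (n + m0)" using component_props(2)[OF _ a] m0(2) by metis
      then show "mdeg m = mdeg m0" by (simp add: mon_map_add)
    next
      assume "mdeg m = mdeg m0"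
      moreover obtain e where "e \<in> keys n" using n(2) keys_eq_empty by blast
      then have "(keys n \<union> keys m0) \<inter> (keys n \<union> keys m) \<noteq> {}" by blast
      ultimately have "(n + m0, n + m) \<in> edge_sharing"
        using pE[OF m] pE[OF m0(1)] nE n(2) by (auto simp: edge_sharing_def keys_plus mon_map_add)
      then show "n + m \<in> component a"
        using m0(2) by (auto simp: component_def intro: rtrancl_into_rtrancl)
    qed
    then have "coeff_sum {m. n + m \<in> component a} p = coeff_sum {m. mdeg m = mdeg m0} p"
      by (intro coeff_sum_cong) simp
    also have "\<dots> = 0" using p by (simp add: toric_iff_coeff_sum)
    finally show ?thesis .
  qed
  have "coeff_sum (component a) (q * p)
      = (\<Sum>n\<in>keys q. lookup q n * coeff_sum {m. n + m \<in> component a} p)"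
    by (rule coeff_sum_mult)
  also have "\<dots> = (\<Sum>n\<in>keys q. if n = 0 then lookup q 0 * coeff_sum (component a) p else 0)"
    by (rule sum.cong) (simp_all add: zero)
  also have "\<dots> = lookup q 0 * coeff_sum (component a) p" by (simp add: in_keys_iff)
  finally show ?thesis .
qed

lemma critical_binomial_in_toric:
  assumes "a \<in> critical"
  shows "single a 1 - single (fibre_base (mdeg a)) 1 \<in> (toric :: ('v set, 'k::field) mpoly set)"
proof -
  have "keys a \<subseteq> E" "keys (fibre_base (mdeg a)) \<subseteq> E" "mdeg (fibre_base (mdeg a)) = mdeg a"
    using assms fibre_base_props by (auto simp: critical_def)
  moreover from this
  have "single a 1 + - single (fibre_base (mdeg a)) (1::'k) \<in> carrier (mpoly_ring E)"
    by (intro mpoly_ring_closed carrier_mpoly_ring_single)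
  ultimately show ?thesis
    by (simp add: toric_iff_coeff_sum coeff_sum_add coeff_sum_uminus coeff_sum_single
        diff_conv_add_uminus del: mpoly_ring_simps(1) add_uminus_conv_diff)
qed

text \<open>The functionals below factor through the toric ideal modulo its product with the maximal ideal of
  the origin, where submodules are just subspaces.\<close>
lemma vanishing_functionals_ideal:
  fixes l :: "('v set \<Rightarrow>\<^sub>0 nat) \<Rightarrow> 'k::field"
  assumes T: "\<And>a. a \<in> T \<Longrightarrow> keys a \<subseteq> E"
  shows "ideal {p \<in> toric. (\<Sum>a\<in>T. l a * coeff_sum (component a) p) = 0} (mpoly_ring E)"
    (is "ideal ?J ?R")
proof -
  interpret R: cring ?R by (rule cring_mpoly_ring)
  interpret P: ideal "toric :: ('v set, 'k) mpoly set" ?R by (rule toric_ideal_ideal)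
  have sub: "toric \<subseteq> carrier ?R" by (rule P.a_subset)
  have mult: "q * p \<in> ?J" if "p \<in> ?J" "q \<in> carrier ?R" for p q
  proof -
    have p: "p \<in> toric" "(\<Sum>a\<in>T. l a * coeff_sum (component a) p) = 0" using that(1) by auto
    have "(\<Sum>a\<in>T. l a * coeff_sum (component a) (q * p))
        = (\<Sum>a\<in>T. l a * (lookup q 0 * coeff_sum (component a) p))"
      using coeff_sum_component_mult[OF p(1) that(2)] T by simp
    also have "\<dots> = lookup q 0 * (\<Sum>a\<in>T. l a * coeff_sum (component a) p)"
      by (simp only: sum_distrib_left mult.left_commute)
    also have "\<dots> = 0" using p(2) by simp
    finally show ?thesis using P.I_l_closed[OF p(1) that(2)] by (simp only: mpoly_ring_simps(2) mem_Collect_eq simp_thms)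
  qed
  have add: "p + q \<in> ?J" if "p \<in> ?J" "q \<in> ?J" for p q
    using that P.a_closed[of p q]
    by (simp add: coeff_sum_add distrib_left sum.distrib)
  show ?thesis
  proof (rule idealI[OF R.ring_axioms])
    show "subgroup ?J (add_monoid ?R)"
    proof (rule R.add.subgroupI)
      show "?J \<subseteq> carrier ?R" using sub by blast
      have "0 \<in> ?J" using P.zero_closed by simp
      then show "?J \<noteq> {}" by blast
      show "\<ominus>\<^bsub>?R\<^esub> p \<in> ?J" if p: "p \<in> ?J" for p
      proof -
        have pc: "p \<in> carrier ?R" using p sub by blast
        have "- 1 * p \<in> ?J" by (rule mult[OF p mpoly_ring_closed(3)[OF mpoly_ring_closed(2)]])
        moreover have "\<ominus>\<^bsub>?R\<^esub> p = - p"
          by (rule R.minus_equality) (use pc mpoly_ring_closed(3)[OF pc] in \<open>simp_all del: mpoly_ring_simps(1)\<close>)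
        ultimately show ?thesis by simp
      qed
      show "p \<oplus>\<^bsub>?R\<^esub> q \<in> ?J" if "p \<in> ?J" "q \<in> ?J" for p q
        using add[OF that] by (simp only: mpoly_ring_simps(3))
    qed
    show "x \<otimes>\<^bsub>?R\<^esub> p \<in> ?J" if "p \<in> ?J" "x \<in> carrier ?R" for p x
      using mult[OF that] by (simp only: mpoly_ring_simps(2))
    show "p \<otimes>\<^bsub>?R\<^esub> x \<in> ?J" if "p \<in> ?J" "x \<in> carrier ?R" for p x
      using mult[OF that] by (simp only: mpoly_ring_simps(2) mult.commute)
  qed
qed

text \<open>The functionals \<open>coeff_sum (component a)\<close> for critical \<open>a\<close> are linearly independent: they are dual to
  the critical binomials. With fewer generators than critical monomials, some nonzero combination
  of these functionals vanishes on the generators, hence on the ideal that they generate, hence on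
  the critical binomials.\<close>
lemma finite_critical_card_le:
  fixes S :: "('v set, 'k::field) mpoly set"
  assumes S: "finite S" "S \<subseteq> carrier (mpoly_ring E)" "Idl\<^bsub>mpoly_ring E\<^esub> S = toric"
  shows "finite critical \<and> card critical \<le> card S"
proof -
  interpret R: cring "mpoly_ring E :: ('v set, 'k) mpoly ring" by (rule cring_mpoly_ring)
  have "card T \<le> card S" if T: "T \<subseteq> critical" "finite T" for T
  proof (rule ccontr)
    assume "\<not> card T \<le> card S"
    then have less: "card S < card T" by simp
    obtain l where l: "\<exists>a\<in>T. l a \<noteq> 0" "\<forall>s\<in>S. (\<Sum>a\<in>T. l a * coeff_sum (component a) s) = 0"
      using underdetermined_system[OF S(1) T(2) less, of "\<lambda>a. coeff_sum (component a)"] by (elim exE conjE)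
    let ?J = "{p \<in> toric. (\<Sum>a\<in>T. l a * coeff_sum (component a) p) = 0}"
    have "ideal ?J (mpoly_ring E)"
      by (rule vanishing_functionals_ideal) (use T in \<open>auto simp: critical_def\<close>)
    moreover have "S \<subseteq> ?J"
      using R.genideal_self[OF S(2)] l(2) unfolding S(3) by (intro subsetI CollectI conjI) auto
    ultimately have "toric \<subseteq> ?J" using R.genideal_minimal S(3) by blast
    from l(1) obtain a where a: "a \<in> T" "l a \<noteq> 0" by blast
    have aC: "a \<in> critical" using a(1) T(1) by blast
    let ?p = "single a 1 - single (fibre_base (mdeg a)) 1 :: ('v set, 'k) mpoly"
    have "?p \<in> ?J" by (rule subsetD[OF \<open>toric \<subseteq> ?J\<close> critical_binomial_in_toric[OF aC]])
    then have zero: "(\<Sum>a'\<in>T. l a' * coeff_sum (component a') ?p) = 0" by (simp only: mem_Collect_eq)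
    have "coeff_sum (component a') ?p = (if a' = a then 1 else 0)" if a': "a' \<in> T" for a'
    proof -
      have a'C: "a' \<in> critical" using a' T(1) by blast
      have reps: "component_rep a' = a'" "component_rep a = a" "fibre_base (mdeg a') \<noteq> a'" "component_rep (fibre_base (mdeg a)) = fibre_base (mdeg a)"
        "keys a' \<subseteq> E"
        using a'C aC fibre_base_props(3) by (auto simp: critical_def)
      have "a \<in> component a' \<longleftrightarrow> a' = a"
        using component_rep_eq[of a a'] reps self_in_component by auto
      moreover have "fibre_base (mdeg a) \<notin> component a'"
      proof
        assume b: "fibre_base (mdeg a) \<in> component a'"
        then have "fibre_base (mdeg a) = a'" using component_rep_eq[OF b] reps by simp
        moreover have "mdeg (fibre_base (mdeg a)) = mdeg a" using aC fibre_base_props(2) by (simp add: critical_def)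
        ultimately show False using reps(3) by simp
      qed
      ultimately have "coeff_sum (component a') (single a 1 + - single (fibre_base (mdeg a)) (1::'k))
          = (if a' = a then 1 else 0)"
        by (simp only: coeff_sum_add coeff_sum_uminus coeff_sum_single) simp
      then show ?thesis by simp
    qed
    then have "(\<Sum>a'\<in>T. l a' * coeff_sum (component a') ?p) = (\<Sum>a'\<in>T. if a' = a then l a' else 0)"
      by (intro sum.cong refl) (auto simp only: mult_1_right mult_zero_right split: if_splits)
    with zero a T(2) show False by simp
  qed
  then show ?thesis by (intro finite_if_finite_subsets_card_bdd)
qed

end

section \<open>Counting critical monomials at a vertex\<close>

context finite_simple_graph begin

abbreviation edges_avoiding :: "'v set \<Rightarrow> 'v set set" where
  "edges_avoiding U \<equiv> {e \<in> E. e \<inter> U = {}}"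

abbreviation critical_avoiding :: "'v set \<Rightarrow> ('v set \<Rightarrow>\<^sub>0 nat) set" where
  "critical_avoiding U \<equiv> {a \<in> critical. keys (mdeg a) \<inter> U = {}}"

text \<open>The differences of critical pairs that avoid \<open>U\<close> span, over the rationals, all linear relations
  between incidence vectors of edges that avoid \<open>U\<close>; this is the dual form. The relation \<open>l\<close> is
  split into its positive and negative part, two monomials of equal degree.\<close>
lemma critical_orthogonal_imp_relations_orthogonal:
  fixes phi :: "'v set \<Rightarrow> int"
  assumes phi: "\<And>a. a \<in> critical_avoiding U \<Longrightarrow>
      (\<Sum>e\<in>edges_avoiding U. phi e * (int (lookup a e) - int (lookup (fibre_base (mdeg a)) e))) = 0"
    and F: "F \<subseteq> edges_avoiding U" and l: "\<And>v. (\<Sum>e\<in>F. l e * of_bool (v \<in> e)) = (0::int)"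
  shows "(\<Sum>e\<in>F. phi e * l e) = 0"
proof -
  let ?EU = "edges_avoiding U"
  define val where "val = (\<lambda>m. \<Sum>e\<in>?EU. phi e * int (lookup m e))"
  \<comment> \<open>Critical pairs that meet \<open>U\<close> do so in both monomials: identifying all monomials that meet \<open>U\<close>
    makes \<open>h\<close> constant on these pairs.\<close>
  define h where "h = (\<lambda>m. if keys m \<subseteq> ?EU then Some (val m) else None)"
  have finF: "finite F" by (rule finite_subset[OF _ finite_E]) (use F in auto)
  have keys_plus: "keys (m + n) = keys m \<union> keys n" for m n :: "'v set \<Rightarrow>\<^sub>0 nat"
    by (auto simp: in_keys_iff lookup_add)
  have val_plus: "val (m + n) = val m + val n" for m n
    by (simp add: val_def lookup_add distrib_left sum.distrib)
  define part where "part = (\<lambda>s. \<Sum>e\<in>F. single e (nat (s * l e)))"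
  have look: "lookup (part s) e = (if e \<in> F then nat (s * l e) else 0)" for s e
    using finF by (simp add: part_def lookup_sum lookup_single when_def)
  have partF: "keys (part s) \<subseteq> F" for s
    by (rule subsetI) (simp add: in_keys_iff look split: if_splits)
  then have partEU: "keys (part s) \<subseteq> ?EU" for s using F by blast
  then have partE: "keys (part s) \<subseteq> E" for s by blast
  have part_sum: "(\<Sum>e\<in>A. w e * int (lookup (part 1) e)) - (\<Sum>e\<in>A. w e * int (lookup (part (- 1)) e))
      = (\<Sum>e\<in>F. w e * l e)" if "F \<subseteq> A" "finite A" for A and w :: "'v set \<Rightarrow> int"
  proof -
    have "(\<Sum>e\<in>A. w e * int (lookup (part 1) e)) - (\<Sum>e\<in>A. w e * int (lookup (part (- 1)) e))
        = (\<Sum>e\<in>A. if e \<in> F then w e * l e else 0)"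
      unfolding sum_subtractf[symmetric] right_diff_distrib[symmetric]
      by (rule sum.cong) (auto simp: look)
    also have "\<dots> = (\<Sum>e\<in>F. w e * l e)"
      using that by (simp add: sum.If_cases Int_absorb1)
    finally show ?thesis .
  qed
  have deg: "mdeg (part 1) = mdeg (part (- 1))"
  proof (rule poly_mapping_eqI)
    fix v
    have "int (lookup (mdeg (part s)) v) = (\<Sum>e\<in>E. of_bool (v \<in> e) * int (lookup (part s) e))" for s
      by (simp add: lookup_mdeg[OF partE] mult.commute)
    then have "int (lookup (mdeg (part 1)) v) - int (lookup (mdeg (part (- 1))) v)
        = (\<Sum>e\<in>F. of_bool (v \<in> e) * l e)"
      using part_sum[of E "\<lambda>e. of_bool (v \<in> e)"] F finite_E by auto
    also have "\<dots> = 0" using l[of v] by (simp add: mult.commute)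
    finally show "lookup (mdeg (part 1)) v = lookup (mdeg (part (- 1))) v" by simp
  qed
  have "h (part 1) = h (part (- 1))"
  proof (rule critical_pairs_generate[OF _ _ partE partE deg])
    fix e m n assume "e \<in> E" "keys m \<subseteq> E" "keys n \<subseteq> E" "h m = h n"
    then show "h (single e 1 + m) = h (single e 1 + n)"
      by (auto simp: h_def keys_plus val_plus split: if_splits)
  next
    fix a assume a: "a \<in> critical"
    then have aE: "keys a \<subseteq> E" by (simp add: critical_def)
    note b = fibre_base_props[OF aE]
    have iff: "keys m \<subseteq> ?EU \<longleftrightarrow> keys (mdeg a) \<inter> U = {}" if "keys m \<subseteq> E" "mdeg m = mdeg a" for m
    proof -
      have "keys (mdeg a) = \<Union>(keys m)"
        using in_keys_mdeg[OF that(1)] unfolding that(2) by blast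
      then show ?thesis using that(1) by blast
    qed
    show "h a = h (fibre_base (mdeg a))"
    proof (cases "keys (mdeg a) \<inter> U = {}")
      case True
      then have "a \<in> critical_avoiding U" using a by blast
      from phi[OF this] have "val a = val (fibre_base (mdeg a))"
        by (simp add: val_def right_diff_distrib sum_subtractf)
      then show ?thesis by (simp add: h_def iff[OF aE refl] iff[OF b(1,2)])
    next
      case False
      then show ?thesis by (simp only: h_def iff[OF aE refl] iff[OF b(1,2)] if_False)
    qed
  qed
  then have "val (part 1) = val (part (- 1))" by (simp add: h_def partEU)
  then show ?thesis using part_sum[OF F, of phi] finite_E by (simp add: val_def)
qed

text \<open>The relations between the incidence vectors of the edges that avoid \<open>U\<close> form a space of dimension
  the number of these edges minus their rank, spanned by the differences of the
  critical pairs that avoid \<open>U\<close>.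
  Were there too few of them, some nonzero weight \<open>phi\<close> on the edges would be orthogonal to all
  critical differences and vanish on a maximal independent set \<open>F\<close>; but every other edge depends on
  \<open>F\<close>, which forces its weight to vanish too.\<close>
lemma many_critical_or_independent_edges:
  assumes fin: "finite critical"
  obtains F where "F \<subseteq> edges_avoiding U" "independent_edges F"
    "card (edges_avoiding U) \<le> card (critical_avoiding U) + card F"
proof -
  let ?EU = "edges_avoiding U" and ?CU = "critical_avoiding U"
  have finEU: "finite ?EU" using finite_E by simp
  have finCU: "finite ?CU" using fin by simp
  let ?I = "{F. F \<subseteq> ?EU \<and> independent_edges F}"
  have "finite ?I" by (rule finite_subset[of _ "Pow ?EU"]) (use finEU in auto)
  moreover have "{} \<in> ?I" by (simp add: independent_edges_def)
  then have "?I \<noteq> {}" by (rule ex_in_conv[THEN iffD1, OF exI])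
  ultimately obtain F where F: "F \<in> ?I" and max: "\<forall>F'\<in>?I. F \<subseteq> F' \<longrightarrow> F = F'"
    by (rule bexE[OF finite_has_maximal])
  have FEU: "F \<subseteq> ?EU" and Find: "independent_edges F" using F by auto
  have finF: "finite F" using finite_subset[OF FEU finEU] .
  have "card ?EU \<le> card ?CU + card F"
  proof (rule ccontr)
    assume "\<not> card ?EU \<le> card ?CU + card F"
    then have "card (?CU <+> F) < card ?EU" using finCU finF by (simp add: card_Plus)
    \<comment> \<open>One equation for each critical pair, and the equation \<open>phi f = 0\<close> for each \<open>f\<close> in \<open>F\<close>.\<close>
    define c :: "'v set \<Rightarrow> _ \<Rightarrow> int" where "c = (\<lambda>e. case_sum
      (\<lambda>a. int (lookup a e) - int (lookup (fibre_base (mdeg a)) e)) (\<lambda>f. of_bool (e = f)))"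
    obtain phi where phi: "\<exists>e\<in>?EU. phi e \<noteq> 0" "\<forall>b\<in>?CU <+> F. (\<Sum>e\<in>?EU. phi e * c e b) = 0"
      using underdetermined_system[OF finite_Plus[OF finCU finF] finEU
          \<open>card (?CU <+> F) < card ?EU\<close>, of c] by (elim exE conjE)
    have phi_crit: "(\<Sum>e\<in>?EU. phi e * (int (lookup a e) - int (lookup (fibre_base (mdeg a)) e))) = 0"
      if "a \<in> ?CU" for a
      using bspec[OF phi(2) InlI[OF that]] unfolding c_def sum.case .
    have phi_F: "phi f = 0" if "f \<in> F" for f
    proof -
      have "(\<Sum>e\<in>?EU. phi e * of_bool (e = f)) = 0"
        using bspec[OF phi(2) InrI[OF that]] unfolding c_def sum.case .
      moreover have "(\<Sum>e\<in>?EU. phi e * of_bool (e = f)) = (\<Sum>e\<in>?EU. if e = f then phi e else 0)"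
        by (rule sum.cong) auto
      ultimately show ?thesis using subsetD[OF FEU that] finEU by simp
    qed
    from phi(1) obtain e where e: "e \<in> ?EU" "phi e \<noteq> 0" by blast
    then have eF: "e \<notin> F" using phi_F by blast
    have "\<not> independent_edges (insert e F)"
    proof
      assume "independent_edges (insert e F)"
      then have "insert e F \<in> ?I" using FEU e(1) by simp
      from bspec[OF max this] show False using eF by auto
    qed
    then obtain l :: "'v set \<Rightarrow> int" and f
      where l: "\<And>v. (\<Sum>x\<in>insert e F. l x * of_bool (v \<in> x)) = 0" and f: "f \<in> insert e F" "l f \<noteq> 0"
      unfolding independent_edges_def by blast
    have "l e \<noteq> 0"
    proof
      assume "l e = 0"
      then have "\<forall>v. (\<Sum>x\<in>F. l x * of_bool (v \<in> x)) = 0" using l unfolding sum.insert[OF finF eF] by simp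
      then have "\<forall>x\<in>F. l x = 0" using Find unfolding independent_edges_def by blast
      then show False using f \<open>l e = 0\<close> by blast
    qed
    have "(\<Sum>x\<in>insert e F. phi x * l x) = 0"
      by (rule critical_orthogonal_imp_relations_orthogonal[OF phi_crit _ l]) (use FEU e(1) in blast)+
    also have "(\<Sum>x\<in>insert e F. phi x * l x) = phi e * l e"
      using eF finF phi_F by simp
    finally show False using e(2) \<open>l e \<noteq> 0\<close> by simp
  qed
  then show ?thesis using that FEU Find by blast
qed

text \<open>With fewer equations than edges in \<open>F\<close>, some nonzero coefficient vector satisfies the equations of
  \<open>W\<close>, hence all vertex equations, against the independence of \<open>F\<close>.\<close>
lemma independent_edges_card_le:
  assumes F: "F \<subseteq> E" "independent_edges F" and W: "W \<subseteq> V"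
    and enough: "\<And>l :: 'v set \<Rightarrow> int. (\<forall>v\<in>W. (\<Sum>e\<in>F. l e * of_bool (v \<in> e)) = 0) \<Longrightarrow>
        (\<forall>v\<in>V. (\<Sum>e\<in>F. l e * of_bool (v \<in> e)) = 0)"
  shows "card F \<le> card W"
proof (rule ccontr)
  assume "\<not> card F \<le> card W"
  then have less: "card W < card F" by simp
  have finW: "finite W" and finF: "finite F" 
    using W finite_V F(1) finite_E finite_subset by blast+
  obtain l :: "'v set \<Rightarrow> int" where l: "\<exists>e\<in>F. l e \<noteq> 0"
      "\<forall>v\<in>W. (\<Sum>e\<in>F. l e * of_bool (v \<in> e)) = 0"
    using underdetermined_system[OF finW finF less, of "\<lambda>e v. of_bool (v \<in> e)"] by (elim exE conjE)
  have "(\<Sum>e\<in>F. l e * of_bool (v \<in> e)) = 0" for v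
  proof (cases "v \<in> V")
    case True
    then show ?thesis using enough[OF l(2)] by blast
  next
    case False
    then have "v \<notin> e" if "e \<in> F" for e using that F(1) edge_subset by blast
    then show ?thesis by simp
  qed
  then show False using F(2) l(1) unfolding independent_edges_def by blast
qed

lemma sum_incidence_part:
  fixes l :: "'v set \<Rightarrow> int"
  assumes F: "F \<subseteq> E" and A: "finite A" and meet: "\<And>e. e \<in> F \<Longrightarrow> card (A \<inter> e) = 1"
  shows "(\<Sum>v\<in>A. \<Sum>e\<in>F. l e * of_bool (v \<in> e)) = (\<Sum>e\<in>F. l e)"
proof -
  have "(\<Sum>v\<in>A. \<Sum>e\<in>F. l e * of_bool (v \<in> e)) = (\<Sum>e\<in>F. \<Sum>v\<in>A. l e * of_bool (v \<in> e))"
    by (rule sum.swap)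
  also have "\<dots> = (\<Sum>e\<in>F. l e)"
  proof (rule sum.cong[OF refl])
    fix e assume "e \<in> F"
    have "(\<Sum>v\<in>A. l e * of_bool (v \<in> e)) = (\<Sum>v\<in>A. if v \<in> e then l e else 0)"
      by (rule sum.cong) simp_all
    also have "\<dots> = (\<Sum>v\<in>A \<inter> e. l e)" by (rule sum.inter_restrict[OF A, symmetric])
    finally show "(\<Sum>v\<in>A. l e * of_bool (v \<in> e)) = l e" using meet[OF \<open>e \<in> F\<close>] by simp
  qed
  finally show ?thesis .
qed

text \<open>For a bipartite graph the vertex equations of the two sides have the same sum, so one of them is
  redundant.\<close>
lemma independent_edges_card_less_bipartite:
  assumes F: "F \<subseteq> E" "independent_edges F" and "V \<noteq> {}" and bip: "bipartite_graph V E"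
  shows "card F < card V"
proof -
  obtain v0 where v0: "v0 \<in> V" using assms(3) by blast
  obtain A B where AB: "A \<union> B = V" "A \<inter> B = {}" "\<forall>e\<in>E. \<exists>a\<in>A. \<exists>b\<in>B. e = {a, b}"
    using bip unfolding bipartite_graph_def by (elim exE conjE)
  have finA: "finite A" and finB: "finite B" using AB(1) finite_V by auto
  have meet: "card (A \<inter> e) = 1 \<and> card (B \<inter> e) = 1" if "e \<in> F" for e
  proof -
    have "e \<in> E" using F(1) that by blast
    then obtain a b where ab: "a \<in> A" "b \<in> B" "e = {a, b}" using AB(3) by blast
    then have "A \<inter> e = {a}" "B \<inter> e = {b}" using AB(2) by blast+
    then show ?thesis by simp
  qed
  have "card F \<le> card (V - {v0})"
  proof (rule independent_edges_card_le[OF F])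
    fix l :: "'v set \<Rightarrow> int"
    let ?s = "\<lambda>v. \<Sum>e\<in>F. l e * of_bool (v \<in> e)"
    assume "\<forall>v\<in>V - {v0}. ?s v = 0"
    then have rest: "?s v = 0" if "v \<in> V" "v \<noteq> v0" for v using that by blast
    have "sum ?s A = sum ?s B"
      using sum_incidence_part[OF F(1) finA, of l] sum_incidence_part[OF F(1) finB, of l] meet
      by simp
    moreover have "sum ?s X = (if v0 \<in> X then ?s v0 else 0)" if "X \<subseteq> V" for X
    proof -
      have "sum ?s X = (\<Sum>v\<in>X. if v = v0 then ?s v0 else 0)"
        using that rest by (intro sum.cong) auto
      then show ?thesis using finite_subset[OF that finite_V] by simp
    qed
    ultimately have "(if v0 \<in> A then ?s v0 else 0) = (if v0 \<in> B then ?s v0 else 0)"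
      using AB(1) by auto
    then have "?s v0 = 0" using v0 AB(1,2) by (auto split: if_splits)
    then show "\<forall>v\<in>V. ?s v = 0" using rest by blast
  qed blast
  then show ?thesis using v0 finite_V
    by (metis card_Diff1_less le_less_trans)
qed

text \<open>The step that uses the complete intersection property, with \<open>n\<close> as the number of generators of
  the toric ideal. Deleting \<open>v\<close> lowers the rank, since an edge
  at \<open>v\<close> is independent of the edges that avoid \<open>v\<close>. The critical monomials that avoid \<open>v\<close> are at least
  as many as the corank of the edges that remain, all critical monomials together are at most the
  corank of \<open>E\<close>, and the difference of these coranks is less than the degree of \<open>v\<close>.\<close>
lemma critical_at_vertex_less_degree:
  assumes S: "finite critical" "card critical \<le> n"
    and n: "\<And>F. F \<subseteq> E \<Longrightarrow> independent_edges F \<Longrightarrow> n \<le> card E - card F"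
    and e0: "e0 \<in> E" "v \<in> e0"
  shows "card {a \<in> critical. v \<in> keys (mdeg a)} < card {e \<in> E. v \<in> e}"
proof -
  obtain F where F: "F \<subseteq> edges_avoiding {v}" "independent_edges F"
    "card (edges_avoiding {v}) \<le> card (critical_avoiding {v}) + card F"
    by (rule many_critical_or_independent_edges[OF S(1)])
  have vF: "v \<notin> e" if "e \<in> F" for e using that F(1) by blast
  have e0F: "e0 \<notin> F" using vF e0(2) by blast
  have FE: "insert e0 F \<subseteq> E" using F(1) e0(1) by blast
  have finF: "finite F" by (rule finite_subset[OF _ finite_E]) (use FE in simp)
  have "independent_edges (insert e0 F)"
    unfolding independent_edges_def
  proof (intro allI impI)
    fix l :: "'v set \<Rightarrow> int"
    assume l: "\<forall>w. (\<Sum>e\<in>insert e0 F. l e * of_bool (w \<in> e)) = 0"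
    have "(\<Sum>e\<in>F. l e * of_bool (v \<in> e)) = 0" by (rule sum.neutral) (simp add: vF)
    then have "l e0 = 0" using spec[OF l, of v] e0F finF e0(2) by simp
    moreover from this have "\<forall>w. (\<Sum>e\<in>F. l e * of_bool (w \<in> e)) = 0" using l unfolding sum.insert[OF finF e0F] by simp
    then have "\<forall>e\<in>F. l e = 0" using F(2) unfolding independent_edges_def by blast
    ultimately show "\<forall>e\<in>insert e0 F. l e = 0" by simp
  qed
  from n[OF FE this] have "card critical \<le> card E - Suc (card F)"
    using S(2) e0F finF by simp
  moreover have "Suc (card F) \<le> card E"
    using card_mono[OF finite_E FE] e0F finF by simp
  moreover have "card critical = card {a \<in> critical. v \<in> keys (mdeg a)} + card (critical_avoiding {v})"
  proof -
    have "critical = {a \<in> critical. v \<in> keys (mdeg a)} \<union> critical_avoiding {v}" by blast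
    from trans[OF arg_cong[OF this, of card] card_Un_disjoint] show ?thesis
      using S(1) by auto
  qed
  moreover have "card E = card {e \<in> E. v \<in> e} + card (edges_avoiding {v})"
  proof -
    have "E = {e \<in> E. v \<in> e} \<union> edges_avoiding {v}" by blast
    from trans[OF arg_cong[OF this, of card] card_Un_disjoint] show ?thesis
      using finite_E by auto
  qed
  ultimately show ?thesis using F(3) by linarith
qed

lemma sum_degrees: "(\<Sum>v\<in>V. card {e \<in> E. v \<in> e}) = 2 * card E"
proof -
  have "(\<Sum>v\<in>V. card {e \<in> E. v \<in> e}) = (\<Sum>e\<in>E. card {v \<in> V. v \<in> e})"
    using sum.swap_restrict[OF finite_V finite_E, of "\<lambda>_ _. 1::nat" "\<lambda>v e. v \<in> e"]
    by simp
  also have "\<dots> = (\<Sum>e\<in>E. 2)"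
  proof (rule sum.cong[OF refl])
    fix e assume e: "e \<in> E"
    have "{v \<in> V. v \<in> e} = e" using edge_subset[OF e] by blast
    then show "card {v \<in> V. v \<in> e} = 2" by (simp add: card_edge[OF e])
  qed
  finally show ?thesis by simp
qed

lemma sum_critical_at_vertices:
  assumes "finite critical"
  shows "4 * card critical \<le> (\<Sum>v\<in>V. card {a \<in> critical. v \<in> keys (mdeg a)})"
proof -
  have "(\<Sum>v\<in>V. card {a \<in> critical. v \<in> keys (mdeg a)})
      = (\<Sum>a\<in>critical. card {v \<in> V. v \<in> keys (mdeg a)})"
    using sum.swap_restrict[OF finite_V assms, of "\<lambda>_ _. 1::nat" "\<lambda>v a. v \<in> keys (mdeg a)"] by simp
  moreover have "(\<Sum>a\<in>critical. 4) \<le> (\<Sum>a\<in>critical. card {v \<in> V. v \<in> keys (mdeg a)})"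
  proof (rule sum_mono)
    fix a assume a: "a \<in> critical"
    then have "{v \<in> V. v \<in> keys (mdeg a)} = keys (mdeg a)"
      using keys_mdeg_subset by (auto simp: critical_def)
    then show "4 \<le> card {v \<in> V. v \<in> keys (mdeg a)}" using four_vertices_of_critical[OF a] by simp
  qed
  ultimately show ?thesis by simp
qed

end

section \<open>The bounds on the number of edges\<close>

lemma connected_graph_no_isolated:
  assumes "simple_graph V E" "connected_graph V E" "E \<noteq> {}" "v \<in> V"
  shows "\<exists>e\<in>E. v \<in> e"
proof -
  obtain e where e: "e \<in> E" using assms(3) by blast
  then have "e \<subseteq> V" "card e = 2" using assms(1) by (auto simp: simple_graph_def)
  then obtain u where u: "u \<in> V" "u \<noteq> v" by (auto simp: card_2_iff)
  then have "(v, u) \<in> {(a, b). {a, b} \<in> E}\<^sup>*"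
    using assms(2,4) by (auto simp: connected_graph_def)
  then show ?thesis using u(2) by (cases rule: converse_rtranclE) auto
qed

theorem corollary3p7:
  fixes V :: "'v set" and E :: "'v set set"
  assumes "simple_graph V E"
    and "connected_graph V E"
    and "E \<noteq> {}"
    and "complete_intersection TYPE('k::field) V E"
  shows "(bipartite_graph V E \<longrightarrow> 2 * card E + 4 \<le> 3 * card V) \<and>
    (\<not> bipartite_graph V E \<longrightarrow> 2 * card E \<le> 3 * card V)"
proof -
  interpret finite_simple_graph V E by standard (rule assms(1))
  obtain S :: "('v set, 'k) mpoly set" where S: "finite S" "S \<subseteq> carrier (mpoly_ring E)"
    "Idl\<^bsub>mpoly_ring E\<^esub> S = toric_ideal V E"
    and few: "\<forall>F. F \<subseteq> E \<longrightarrow> independent_edges F \<longrightarrow> card S \<le> card E - card F"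
    by (rule complete_intersection_generators[OF assms(4)])
  have crit: "finite critical" "card critical \<le> card S"
    using finite_critical_card_le[OF S] by blast+
  have "card {a \<in> critical. v \<in> keys (mdeg a)} + 1 \<le> card {e \<in> E. v \<in> e}" if v: "v \<in> V" for v
  proof -
    obtain e where "e \<in> E" "v \<in> e" using connected_graph_no_isolated[OF assms(1-3) v] by blast
    from critical_at_vertex_less_degree[OF crit few[rule_format] this] show ?thesis by simp
  qed
  then have "(\<Sum>v\<in>V. card {a \<in> critical. v \<in> keys (mdeg a)} + 1) \<le> (\<Sum>v\<in>V. card {e \<in> E. v \<in> e})"
    by (rule sum_mono)
  then have upper: "4 * card critical + card V \<le> 2 * card E"
    using sum_critical_at_vertices[OF crit(1)] unfolding sum_degrees sum.distrib by simp
  obtain F where F: "F \<subseteq> E" "independent_edges F" "card E \<le> card critical + card F"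
    using many_critical_or_independent_edges[OF crit(1), of "{}"] by auto
  have "card F \<le> card V" by (rule independent_edges_card_le[OF F(1,2)]) auto
  moreover have "card F < card V" if "bipartite_graph V E"
    using independent_edges_card_less_bipartite[OF F(1,2) _ that] assms(2)
    by (simp add: connected_graph_def)
  ultimately show ?thesis using upper F(3) by fastforce
qed

end
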